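(* Let $X$ be a diffusion on $\mathcal{I}$ as in the context, let $\alpha>0$, and let $g\colon\mathcal{I}\to\mathbb{R}$ be a (non-negative, lower semicontinuous) reward function. Assume that the value function $V_\alpha$ of the optimal stopping problem with reward $g$ and discount $\alpha$ satisfies $$V_\alpha(x)=\int_{(x^*,r]}G_\alpha(x,y)\,(\alpha-L)g(y)\,m(dy)\qquad(x\in\mathcal{I})$$ for some $x^*\in(\ell,r)$. If the speed measure does not charge $x^*$, i.e. $m(\{x^*\})=0$, then there is scale smooth fit: $V_\alpha$ has a derivative at $x^*$ with respect to the scale function $s$, i.e. $\lim_{x\to x^*}\frac{V_\alpha(x)-V_\alpha(x^* )}{s(x)-s(x^* )}$ exists (and is finite).
   Context: $X=\{X_t\colon t\ge 0\}$ is a non-terminating regular one-dimensional diffusion (in the sense of Itô and McKean) with state space an interval $\mathcal{I}\subseteq\mathbb{R}$ with endpoints $\ell=\inf\mathcal{I}$, $r=\sup\mathcal{I}$, $-\infty\le\ell<r\le\infty$. There are no absorbing or killing boundaries; an endpoint belonging to $\mathcal{I}$ is both entrance and exit (reflecting). $\mathbf{E}_x$ is expectation when $X$ starts at $x$. $\mathbf{T}$ is the set of stopping times of the usual augmentation of the natural filtration of $X$. Fix $\alpha>0$. Optimal stopping problem: given a non-negative lower semicontinuous reward $g\colon\mathcal{I}\to\mathbb{R}$, the value function is $V_\alpha(x)=\sup_{\tau\in\mathbf{T}}\mathbf{E}_x\left(e^{-\alpha\tau}g(X_\tau)\right)$ (with the convention $e^{-\alpha\tau}g(X_\tau)=0$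 on $\{\tau=\infty\}$). $s$ and $m$ are the scale function and speed measure of $X$. $L$ is the infinitesimal generator; its domain $\mathcal{D}_L$ is the range of the resolvent $R_\alpha u(x)=\int_0^\infty e^{-\alpha t}\mathbf{E}_x(u(X_t))\,dt$ on bounded continuous functions $u$ on $\mathcal I$, with $(\alpha-L)$ inverse to $R_\alpha$. For a function $u\colon\mathcal{I}\to\mathbb{R}$ and $x\in(\ell,r)$, $Lu(x)$ means Feller's differential operator $Lu(x)=\frac{\partial}{\partial m}\frac{\partial^+}{\partial s}u(x)$ whenever it makes sense ($\partial^+/\partial s$ is the right derivative with respect to $s$, and one has $\frac{\partial^+u}{\partial s}(z)-\frac{\partial^+u}{\partial s}(y)=\int_{(y,z]}Lu\,dm$ for $u\in\mathcal D_L$); if $\ell\in\mathcal{I}$, $Lu(\ell)=\lim_{x\to\ell^+}Lu(x)$, and if $r\in\mathcal{I}$, $Lu(r)=\lim_{x\to r^-}Lu(x)$, when the limits exist. $(\alpha-L)u=\alpha u-Lu$. $\varphi_\alpha$ (decreasing) and $\psi_\alpha$ (increasing) are the positive continuous solutions of $\alpha u=Lu$ on $\mathcal{I}$, whose linear combinations give all continuous solutions; with $\tau_z=\inf\{t\colon X_t=z\}$, $\mathbf{E}_x(e^{-\alpha\tau_z})=\psi_\alpha(x)/\psi_\alpha(z)$ for $x\le z$ and $=\varphi_\alpha(x)/\varphi_\alpha(z)$ for $x\ge z$. The Wronskian $w_\alpha=\frac{\partial^+\psi_\alpha}{\partial s}(x)\varphi_\alpha(x)-\psi_\alpha(x)\frac{\partial^+\varphi_\alpha}{\partial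 s}(x)$ is positive and independent of $x$. The Green function is $G_\alpha(x,y)=\int_0^\infty e^{-\alpha t}p(t;x,y)\,dt$, where $p$ is the transition density with respect to $m$; it equals $w_\alpha^{-1}\psi_\alpha(x)\varphi_\alpha(y)$ for $x\le y$ and $w_\alpha^{-1}\psi_\alpha(y)\varphi_\alpha(x)$ for $x\ge y$. Interval convention: $(x,r]$ denotes $\mathcal{I}\cap\{y>x\}$. *)

theory Defs
  imports "HOL-Probability.Probability"
begin

section \<open>Filtrations and hitting times\<close>

text \<open>A process is a function \<open>X :: real \<Rightarrow> 'w \<Rightarrow> real\<close> on a sample space \<open>\<Omega>\<close>, relevant only at
  times \<open>t \<ge> 0\<close>. Filtrations are indexed by \<^typ>\<open>ennreal\<close> because stopping times may be infinite;
  the member at time \<open>\<top>\<close> is generated by the whole process.\<close>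

definition natural_filtration :: "'w set \<Rightarrow> (real \<Rightarrow> 'w \<Rightarrow> real) \<Rightarrow> ennreal \<Rightarrow> 'w measure" where
  "natural_filtration \<Omega> X t =
     sigma \<Omega> {X u -` B \<inter> \<Omega> | u B. 0 \<le> u \<and> ennreal u \<le> t \<and> B \<in> sets borel}"

text \<open>The disjunct \<open>u = \<top>\<close> changes nothing for \<open>t < \<top>\<close>; at \<open>t = \<top>\<close> it prevents an intersection over
  the empty family.\<close>

definition right_filtration :: "'w set \<Rightarrow> (real \<Rightarrow> 'w \<Rightarrow> real) \<Rightarrow> ennreal \<Rightarrow> 'w measure" where
  "right_filtration \<Omega> X t =
     sigma \<Omega> {A. \<forall>u. t < u \<or> u = \<top> \<longrightarrow> A \<in> sets (natural_filtration \<Omega> X u)}"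

text \<open>Here \<open>\<mu> \<bind> P\<close> is the law of the process with initial distribution \<open>\<mu>\<close>; an augmented event has
  to lie, for every such law, in the \<open>\<sigma>\<close>-algebra enlarged by the negligible sets of that law.\<close>

definition usual_augmentation ::
    "real set \<Rightarrow> 'w set \<Rightarrow> (real \<Rightarrow> 'w \<Rightarrow> real) \<Rightarrow> (real \<Rightarrow> 'w measure) \<Rightarrow> ennreal \<Rightarrow> 'w measure" where
  "usual_augmentation I \<Omega> X P t = sigma \<Omega>
     {A. \<forall>\<mu> \<in> space (prob_algebra (restrict_space borel I)). \<forall>u. t < u \<or> u = \<top> \<longrightarrow>
        A \<in> sigma_sets \<Omega> (sets (natural_filtration \<Omega> X u) \<union>
              {N. \<exists>N' \<in> null_sets (\<mu> \<bind> P). N \<subseteq> N'})}"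

definition hitting_time :: "(real \<Rightarrow> 'w \<Rightarrow> real) \<Rightarrow> real \<Rightarrow> 'w \<Rightarrow> ennreal" where
  "hitting_time X y \<omega> = (INF t \<in> {t. 0 \<le> t \<and> X t \<omega> = y}. ennreal t)"


section \<open>Regular non-terminating diffusions\<close>

text \<open>All paths stay in \<open>I\<close> for all times, so there is no killing and endpoints outside \<open>I\<close> are not
  reached. Regularity is required between arbitrary points of \<open>I\<close>: an endpoint in \<open>I\<close> can be
  reached from the interior (exit) and can be left for the interior (entrance), so it is not
  absorbing.\<close>

locale diffusion =
  fixes I :: "real set" and \<Omega> :: "'w set" and X :: "real \<Rightarrow> 'w \<Rightarrow> real" and P :: "real \<Rightarrow> 'w measure"
  assumes interval: "is_interval I" "interior I \<noteq> {}"
    and kernel: "P \<in> restrict_space borel I \<rightarrow>\<^sub>M prob_algebra (natural_filtration \<Omega> X \<top>)"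
    and state: "\<And>\<omega> t. \<omega> \<in> \<Omega> \<Longrightarrow> 0 \<le> t \<Longrightarrow> X t \<omega> \<in> I"
    and continuous_paths: "\<And>\<omega>. \<omega> \<in> \<Omega> \<Longrightarrow> continuous_on {0..} (\<lambda>t. X t \<omega>)"
    and start: "\<And>x. x \<in> I \<Longrightarrow> AE \<omega> in P x. X 0 \<omega> = x"
    and strong_Markov: "\<And>x T A t B. x \<in> I \<Longrightarrow> stopping_time (right_filtration \<Omega> X) T \<Longrightarrow>
          A \<in> sets (filtration.pre_sigma \<Omega> (right_filtration \<Omega> X) T) \<Longrightarrow> 0 \<le> t \<Longrightarrow> B \<in> sets borel \<Longrightarrow>
          emeasure (P x) {\<omega> \<in> A. T \<omega> < \<top> \<and> X (enn2real (T \<omega>) + t) \<omega> \<in> B} =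
          (\<integral>\<^sup>+ \<omega> \<in> {\<omega> \<in> A. T \<omega> < \<top>}. emeasure (P (X (enn2real (T \<omega>)) \<omega>)) {\<omega>' \<in> \<Omega>. X t \<omega>' \<in> B} \<partial>P x)"
    and regular: "\<And>x y. x \<in> I \<Longrightarrow> y \<in> I \<Longrightarrow> 0 < emeasure (P x) {\<omega> \<in> \<Omega>. hitting_time X y \<omega> < \<top>}"

definition resolvent ::
    "(real \<Rightarrow> 'w \<Rightarrow> real) \<Rightarrow> (real \<Rightarrow> 'w measure) \<Rightarrow> real \<Rightarrow> (real \<Rightarrow> real) \<Rightarrow> real \<Rightarrow> real" where
  "resolvent X P \<alpha> u x = (LINT t:{0..}|lborel. exp (- \<alpha> * t) * (LINT \<omega>|P x. u (X t \<omega>)))"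


section \<open>Scale function, speed measure and generator\<close>

definition scale_function ::
    "real set \<Rightarrow> 'w set \<Rightarrow> (real \<Rightarrow> 'w \<Rightarrow> real) \<Rightarrow> (real \<Rightarrow> 'w measure) \<Rightarrow> (real \<Rightarrow> real) \<Rightarrow> bool" where
  "scale_function I \<Omega> X P s \<longleftrightarrow> continuous_on I s \<and> strict_mono_on I s \<and>
     (\<forall>a\<in>I. \<forall>b\<in>I. \<forall>x. a < x \<and> x < b \<longrightarrow>
        measure (P x) {\<omega> \<in> \<Omega>. hitting_time X b \<omega> < hitting_time X a \<omega>} = (s x - s a) / (s b - s a))"

definition has_right_scale_deriv :: "(real \<Rightarrow> real) \<Rightarrow> (real \<Rightarrow> real) \<Rightarrow> real \<Rightarrow> real \<Rightarrow> bool" where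
  "has_right_scale_deriv s u d x \<longleftrightarrow> ((\<lambda>y. (u y - u x) / (s y - s x)) \<longlongrightarrow> d) (at_right x)"

definition right_scale_deriv :: "(real \<Rightarrow> real) \<Rightarrow> (real \<Rightarrow> real) \<Rightarrow> real \<Rightarrow> real" where
  "right_scale_deriv s u x = Lim (at_right x) (\<lambda>y. (u y - u x) / (s y - s x))"

text \<open>Integrated form of \<open>h = d/dm d\<^sup>+/ds f\<close> for \<open>f\<close> in the domain of the generator. At endpoints
  in \<open>I\<close> the derivative with respect to \<open>m\<close> is taken with the convention that the scale derivative
  vanishes beyond the endpoint, which is how \<open>m\<close> is normalised there (at the right endpoint the
  quotient below is the left scale derivative).\<close>

definition Feller_domain ::
    "real set \<Rightarrow> (real \<Rightarrow> real) \<Rightarrow> real measure \<Rightarrow> (real \<Rightarrow> real) \<Rightarrow> (real \<Rightarrow> real) \<Rightarrow> bool" where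
  "Feller_domain I s m f h \<longleftrightarrow>
     continuous_on I f \<and>
     (\<forall>x \<in> interior I. \<exists>d. has_right_scale_deriv s f d x) \<and>
     (\<forall>y \<in> interior I. \<forall>z \<in> interior I. y < z \<longrightarrow>
        right_scale_deriv s f z - right_scale_deriv s f y = (LINT x:{y<..z}|m. h x)) \<and>
     (\<forall>e \<in> I. (\<forall>y\<in>I. e \<le> y) \<longrightarrow>
        ((\<lambda>y. (f y - f e) / (s y - s e)) \<longlongrightarrow> measure m {e} * h e) (at e within I)) \<and>
     (\<forall>e \<in> I. (\<forall>y\<in>I. y \<le> e) \<longrightarrow>
        ((\<lambda>y. (f y - f e) / (s y - s e)) \<longlongrightarrow> - (measure m {e} * h e)) (at e within I))"

text \<open>The speed measure associated with the scale \<open>s\<close>: on its domain, the range of the resolvents on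
  bounded continuous functions, the generator \<open>\<beta> - R\<^sub>\<beta>\<^sup>-\<^sup>1\<close> is \<open>d/dm d\<^sup>+/ds\<close>.\<close>

definition speed_measure ::
    "real set \<Rightarrow> (real \<Rightarrow> 'w \<Rightarrow> real) \<Rightarrow> (real \<Rightarrow> 'w measure) \<Rightarrow> (real \<Rightarrow> real) \<Rightarrow> real measure \<Rightarrow> bool" where
  "speed_measure I X P s m \<longleftrightarrow>
     sets m = sets borel \<and> emeasure m (- I) = 0 \<and>
     (\<forall>a\<in>I. \<forall>b\<in>I. emeasure m {a..b} < \<top>) \<and>
     (\<forall>a\<in>I. \<forall>b\<in>I. a < b \<longrightarrow> 0 < emeasure m {a<..<b}) \<and>
     (\<forall>\<beta>>0. \<forall>u. continuous_on I u \<and> bounded (u ` I) \<longrightarrow>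
        Feller_domain I s m (resolvent X P \<beta> u) (\<lambda>x. \<beta> * resolvent X P \<beta> u x - u x))"

text \<open>Pointwise differential operator \<open>L u (x) = d/dm d\<^sup>+/ds u (x)\<close>. In the interior the derivative
  with respect to \<open>m\<close> is the limit over intervals \<open>(y, z]\<close> with \<open>y < x < z\<close> shrinking to \<open>x\<close>, which also
  covers atoms of \<open>m\<close>.\<close>

definition has_interior_generator ::
    "(real \<Rightarrow> real) \<Rightarrow> real measure \<Rightarrow> (real \<Rightarrow> real) \<Rightarrow> real \<Rightarrow> real \<Rightarrow> bool" where
  "has_interior_generator s m u x d \<longleftrightarrow>
     (\<forall>\<^sub>F y in nhds x. \<exists>e. has_right_scale_deriv s u e y) \<and>
     ((\<lambda>(y, z). (right_scale_deriv s u z - right_scale_deriv s u y) / measure m {y<..z}) \<longlongrightarrow> d)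
       (at_left x \<times>\<^sub>F at_right x)"

definition has_generator ::
    "real set \<Rightarrow> (real \<Rightarrow> real) \<Rightarrow> real measure \<Rightarrow> (real \<Rightarrow> real) \<Rightarrow> real \<Rightarrow> real \<Rightarrow> bool" where
  "has_generator I s m u x d \<longleftrightarrow>
     (if x \<in> interior I then has_interior_generator s m u x d
      else \<exists>h. (\<forall>\<^sub>F y in at x within I. has_interior_generator s m u y (h y)) \<and>
               (h \<longlongrightarrow> d) (at x within I))"

definition generator ::
    "real set \<Rightarrow> (real \<Rightarrow> real) \<Rightarrow> real measure \<Rightarrow> (real \<Rightarrow> real) \<Rightarrow> real \<Rightarrow> real" where
  "generator I s m u x = (THE d. has_generator I s m u x d)"


section \<open>Green function and value function\<close>

definition transition_density ::
    "real set \<Rightarrow> 'w set \<Rightarrow> (real \<Rightarrow> 'w \<Rightarrow> real) \<Rightarrow> (real \<Rightarrow> 'w measure) \<Rightarrow> real measure \<Rightarrow>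
     (real \<Rightarrow> real \<Rightarrow> real \<Rightarrow> real) \<Rightarrow> bool" where
  "transition_density I \<Omega> X P m p \<longleftrightarrow>
     (\<lambda>(t, x, y). p t x y) \<in> borel_measurable (restrict_space borel ({0<..} \<times> I \<times> I)) \<and>
     (\<forall>t>0. \<forall>x\<in>I. \<forall>y\<in>I. 0 \<le> p t x y) \<and>
     (\<forall>t>0. \<forall>x\<in>I. \<forall>B\<in>sets borel.
        emeasure (P x) {\<omega> \<in> \<Omega>. X t \<omega> \<in> B} = (\<integral>\<^sup>+ y \<in> B \<inter> I. ennreal (p t x y) \<partial>m))"

definition Green_function :: "(real \<Rightarrow> real \<Rightarrow> real \<Rightarrow> real) \<Rightarrow> real \<Rightarrow> real \<Rightarrow> real \<Rightarrow> real" where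
  "Green_function p \<alpha> x y = (LINT t:{0<..}|lborel. exp (- \<alpha> * t) * p t x y)"

definition lower_semicontinuous_on :: "real set \<Rightarrow> (real \<Rightarrow> real) \<Rightarrow> bool" where
  "lower_semicontinuous_on I g \<longleftrightarrow> (\<forall>a. openin (top_of_set I) {x \<in> I. a < g x})"

text \<open>The completion is needed since stopping times of the augmented filtration are measurable only
  up to negligible sets.\<close>

definition value_function ::
    "real set \<Rightarrow> 'w set \<Rightarrow> (real \<Rightarrow> 'w \<Rightarrow> real) \<Rightarrow> (real \<Rightarrow> 'w measure) \<Rightarrow> real \<Rightarrow> (real \<Rightarrow> real) \<Rightarrow>
     real \<Rightarrow> ennreal" where
  "value_function I \<Omega> X P \<alpha> g x =
     (SUP \<tau> \<in> {\<tau>. stopping_time (usual_augmentation I \<Omega> X P) \<tau>}.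
        \<integral>\<^sup>+ \<omega>. (if \<tau> \<omega> = \<top> then 0
              else ennreal (exp (- \<alpha> * enn2real (\<tau> \<omega>)) * g (X (enn2real (\<tau> \<omega>)) \<omega>)))
          \<partial>completion (P x))"

end

(* Only the resolvent equation near xs is used; neither psi and phi nor any boundary behaviour enters.
   For u >= 0 let F = R u, and let G be the Green function of d/dm d/ds on (a, b) killed at both ends.
   Integrating twice, the excess at xs of the s-chord of F through a and b equals the integral of
   G(xs, z) (alpha F - u)(z) m(dz) over (a, b].  On a small interval centred at xs this yields a Harnack
   inequality F <= 3 F(xs), hence two-sided bounds on the excess.  Being linear in u, these bounds
   pass from F to the densities of the resolvent at a, xs and b, m-almost everywhere, and can then be
   integrated against (alpha - L) g.  The result bounds the difference of the difference quotients of V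
   at xs towards b and towards a by an integral over (a, b], which tends to 0 because m does not
   charge xs; the quotients are therefore Cauchy at xs. *)

theory Submission
  imports Defs
begin

text \<open>The obstacle is integrability. The function \<open>(\<alpha> - L) g\<close> is known to
  be integrable only after multiplication by the Green function, not with respect to
  \<open>m\<close> alone near \<open>xs\<close>; and the Green function, being built from a
  transition density, is determined in its second argument only up to \<open>m\<close>-null sets. So
  the estimates on it hold almost everywhere in \<open>y\<close> for fixed \<open>a\<close> and
  \<open>b\<close>; the null set may depend on \<open>a\<close> and \<open>b\<close>, which does no
  harm once everything is integrated. Every error term has to be dominated by the kernel at the
  single point \<open>xs\<close>, whose product with \<open>(\<alpha> - L) g\<close> serves as the
  common majorant for all \<open>a\<close> and \<open>b\<close>. The excess contains the values of
  \<open>F\<close> on the whole interval: the Harnack inequality trades them for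
  \<open>F xs\<close>. It also contains \<open>u\<close> itself, that is, the density 1: the mass of
  \<open>u\<close> near \<open>xs\<close> is at most a multiple of \<open>F xs\<close>, so near
  \<open>xs\<close> the density 1 is at most a multiple of the kernel at \<open>xs\<close>.\<close>

section \<open>Monotonicity and constancy from one-sided information\<close>

text \<open>Continuous induction: the points \<open>t\<close> with \<open>f a \<le> f t\<close> form
  a closed set, and the local hypothesis at its supremum \<open>c\<close> would produce a larger
  member if \<open>c < b\<close>.\<close>

lemma le_if_eventually_le_at_right:
  fixes f :: "real \<Rightarrow> real"
  assumes "a \<le> b" and cont: "continuous_on {a..b} f"
    and incr: "\<And>t. a \<le> t \<Longrightarrow> t < b \<Longrightarrow> \<forall>\<^sub>F y in at_right t. f t \<le> f y"
  shows "f a \<le> f b"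
proof -
  define T where "T = {t \<in> {a..b}. f a \<le> f t}"
  have "closed T" unfolding T_def
    by (rule continuous_on_closed_Collect_le) (auto intro: cont continuous_intros)
  have ne: "T \<noteq> {}" and bdd: "bdd_above T" using \<open>a \<le> b\<close> by (auto simp: T_def intro!: bdd_aboveI[of _ b])
  define c where "c = Sup T"
  have cT: "c \<in> T" unfolding c_def by (rule closed_contains_Sup[OF ne bdd \<open>closed T\<close>])
  show ?thesis
  proof (cases "c < b")
    case True
    have "a \<le> c" using cT by (auto simp: T_def)
    have "\<forall>\<^sub>F y in at_right c. f c \<le> f y \<and> y \<in> {c<..<b}"
      using incr[OF \<open>a \<le> c\<close> True] eventually_at_right_real[OF True] by eventually_elim auto
    then obtain y where "f c \<le> f y" "c < y" "y < b"
      using eventually_happens[of _ "at_right c"] by (auto simp: trivial_limit_at_right_real)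
    then have "y \<in> T" using cT by (auto simp: T_def)
    then have "y \<le> c" unfolding c_def by (rule cSup_upper[OF _ bdd])
    with \<open>c < y\<close> show ?thesis by simp
  next
    case False
    then show ?thesis using cT by (auto simp: T_def)
  qed
qed

lemma eq_if_right_scale_deriv_zero:
  assumes "a \<le> b" and cs: "continuous_on {a..b} s" and ms: "strict_mono_on {a..b} s"
    and cont: "continuous_on {a..b} W"
    and deriv: "\<And>t. a \<le> t \<Longrightarrow> t < b \<Longrightarrow> has_right_scale_deriv s W 0 t"
  shows "W b = W a"
proof -
  have bound: "\<bar>W b - W a\<bar> \<le> e * (s b - s a)" if "e > 0" for e
  proof -
    have small: "\<forall>\<^sub>F y in at_right t. \<bar>W y - W t\<bar> \<le> e * (s y - s t)" if t: "a \<le> t" "t < b" for t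
    proof -
      have "\<forall>\<^sub>F y in at_right t. \<bar>(W y - W t) / (s y - s t)\<bar> < e"
        using tendstoD[OF deriv[OF t, unfolded has_right_scale_deriv_def] \<open>e > 0\<close>] by (simp add: dist_real_def)
      then show ?thesis using eventually_at_right_real[OF t(2)]
      proof eventually_elim
        case (elim y)
        have "s t < s y" using elim t by (intro strict_mono_onD[OF ms]) auto
        with elim show ?case by (simp add: abs_divide divide_less_eq less_imp_le split: if_splits)
      qed
    qed
    have "W a + e * s a \<le> W b + e * s b"
      by (rule le_if_eventually_le_at_right[where f = "\<lambda>t. W t + e * s t", OF \<open>a \<le> b\<close>])
        (auto intro!: continuous_intros cs cont elim!: eventually_mono[OF small] simp: algebra_simps)
    moreover have "e * s a - W a \<le> e * s b - W b"
      by (rule le_if_eventually_le_at_right[where f = "\<lambda>t. e * s t - W t", OF \<open>a \<le> b\<close>])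
        (auto intro!: continuous_intros cs cont elim!: eventually_mono[OF small] simp: algebra_simps)
    ultimately show ?thesis by (simp add: algebra_simps abs_le_iff)
  qed
  have "((\<lambda>e. e * (s b - s a)) \<longlongrightarrow> 0 * (s b - s a)) (at_right 0)"
    by (intro tendsto_intros)
  then have "\<bar>W b - W a\<bar> \<le> 0 * (s b - s a)"
    by (rule tendsto_lowerbound)
      (auto intro!: bound eventually_at_right_less[THEN eventually_mono] simp: trivial_limit_at_right_real)
  then show ?thesis by simp
qed

section \<open>The killed Green function and the chord equation\<close>

text \<open>In the scale coordinate, the Green function of d/dm d/ds on \<open>(A, B)\<close> killed at the endpoints;
  the form below, valid for \<open>z \<le> B\<close>, is the one produced by a Taylor expansion at \<open>A\<close>.\<close>

definition chord_kernel :: "real \<Rightarrow> real \<Rightarrow> real \<Rightarrow> real \<Rightarrow> real" where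
  "chord_kernel A B x z = (x - A) / (B - A) * (B - z) - max 0 (x - z)"

lemma chord_kernel_eq:
  assumes "A < B"
  shows "chord_kernel A B x z =
    (if x \<le> z then (x - A) * (B - z) / (B - A) else (z - A) * (B - x) / (B - A))"
proof (cases "x \<le> z")
  case False
  have "(x - A) / (B - A) * (B - z) - (x - z) = ((x - A) * (B - z) - (x - z) * (B - A)) / (B - A)"
    using assms by (simp add: field_simps)
  also have "(x - A) * (B - z) - (x - z) * (B - A) = (z - A) * (B - x)"
    by (simp add: algebra_simps)
  finally show ?thesis using False by (simp add: chord_kernel_def)
qed (simp add: chord_kernel_def)

text \<open>As a function of \<open>z\<close> the kernel is a tent that vanishes at \<open>A\<close>
  and \<open>B\<close>, has its peak at \<open>z = x\<close> and has slopes of absolute value at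
  most 1; the peak value gives the second bound, the slopes give the last two.\<close>

lemma chord_kernel_bounds:
  assumes "A < B" "A \<le> x" "x \<le> B" "A \<le> z" "z \<le> B"
  shows "0 \<le> chord_kernel A B x z"
    and "chord_kernel A B x z \<le> (x - A) * (B - x) / (B - A)"
    and "chord_kernel A B x z \<le> z - A" "chord_kernel A B x z \<le> B - z"
proof -
  show "0 \<le> chord_kernel A B x z"
    using assms by (simp add: chord_kernel_eq)
  show "chord_kernel A B x z \<le> (x - A) * (B - x) / (B - A)"
    using assms by (auto simp: chord_kernel_eq intro!: divide_right_mono mult_mono)
  have "(x - A) * (B - z) \<le> (z - A) * (B - A)" if "x \<le> z"
    using that assms by (intro mult_mono) auto
  moreover have "(z - A) * (B - x) \<le> (z - A) * (B - A)"
    using assms by (intro mult_mono) auto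
  ultimately show "chord_kernel A B x z \<le> z - A"
    using assms by (auto simp: chord_kernel_eq divide_le_eq)
  have "(x - A) * (B - z) \<le> (B - z) * (B - A)"
    using assms by (subst mult.commute, intro mult_mono) auto
  moreover have "(z - A) * (B - x) \<le> (B - z) * (B - A)" if "\<not> x \<le> z"
    using that assms by (subst mult.commute, intro mult_mono) auto
  ultimately show "chord_kernel A B x z \<le> B - z"
    using assms by (auto simp: chord_kernel_eq divide_le_eq)
qed

lemma chord_kernel_midpoint:
  assumes "0 < h"
  shows "chord_kernel (x - h) (x + h) x z = (h - \<bar>z - x\<bar>) / 2"
  using assms by (auto simp: chord_kernel_def max_def abs_if field_simps)

lemma set_integrable_Ioc_if_continuous:
  fixes k :: "real \<Rightarrow> real"
  assumes m: "sets m = sets borel" "emeasure m {a..b} < \<top>"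
    and k: "continuous_on {a..b} k"
  shows "set_integrable m {a<..b} k"
proof -
  have "bounded (k ` {a..b})"
    by (rule compact_imp_bounded[OF compact_continuous_image[OF k]]) simp
  then obtain B where B: "\<forall>z\<in>{a..b}. \<bar>k z\<bar> \<le> B"
    by (auto simp: bounded_iff)
  have "(\<lambda>z. indicator {a..b} z *\<^sub>R k z) \<in> borel_measurable borel"
    by (rule borel_measurable_continuous_on_indicator[OF _ k]) simp
  then have meas: "(\<lambda>z. indicator {a..b} z *\<^sub>R k z) \<in> borel_measurable m"
    using m(1) by (simp cong: measurable_cong_sets)
  have "set_integrable m {a..b} k"
    unfolding set_integrable_def
    by (rule integrableI_bounded_set[where A = "{a..b}" and B = B])
      (use m meas B in \<open>auto simp: indicator_def\<close>)
  then show ?thesis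
    by (rule set_integrable_subset) (auto simp: m)
qed

text \<open>A Taylor formula of second order in the scale:
  \<open>F y = F a + d a * (s y - s a) + J y\<close>. It is verified by differentiation: the
  remainder \<open>J\<close> has right scale derivative \<open>d t - d a\<close>, so
  \<open>F - d a * s - J\<close> has right scale derivative 0 and is constant. The chord through
  \<open>a\<close> and \<open>b\<close> is the combination of these formulas that eliminates the
  slope \<open>d a\<close>.\<close>

lemma chord_equation:
  assumes m: "sets m = sets borel" "emeasure m {a..b} < \<top>" and ab: "a < b" "x \<in> {a..b}"
    and cs: "continuous_on {a..b} s" and ms: "strict_mono_on {a..b} s"
    and F: "continuous_on {a..b} F" and h: "continuous_on {a..b} h"
    and deriv: "\<And>t. t \<in> {a..b} \<Longrightarrow> has_right_scale_deriv s F (d t) t"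
    and d: "\<And>t. a < t \<Longrightarrow> t \<le> b \<Longrightarrow> d t - d a = (LINT z:{a<..t}|m. h z)"
  shows "(s b - s x) / (s b - s a) * F a + (s x - s a) / (s b - s a) * F b - F x =
    (LINT z:{a<..b}|m. chord_kernel (s a) (s b) (s x) (s z) * h z)"
proof -
  have h_int: "set_integrable m {a<..b} h"
    by (rule set_integrable_Ioc_if_continuous[OF m h])
  have ramp_int: "set_integrable m {a<..b} (\<lambda>z. max 0 (c - s z) * h z)" for c
    by (rule set_integrable_Ioc_if_continuous[OF m]) (intro continuous_intros cs h)
  \<comment> \<open>The iterated integral of \<open>h\<close>, first against \<open>m\<close> over
    \<open>{a<..v}\<close> and then against \<open>s\<close> up to \<open>t\<close>, written as a
    single integral against a ramp. The domain of integration stays fixed while \<open>t\<close>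
    varies, so that only the integrand has to be differentiated.\<close>
  define J where "J t = (LINT z:{a<..b}|m. max 0 (s t - s z) * h z)" for t
  have J_diff: "J y - J t = (LINT z:{a<..b}|m. (max 0 (s y - s z) - max 0 (s t - s z)) * h z)" for y t
    unfolding J_def by (subst set_integral_diff(2)[symmetric, OF ramp_int ramp_int]) (simp add: algebra_simps)
  have s_mono: "s y < s z" if "a \<le> y" "y < z" "z \<le> b" for y z
    using that by (intro strict_mono_onD[OF ms]) auto
  have J_cont: "continuous_on {a..b} J"
  proof (rule continuous_on_eq)
    have norm_int: "set_integrable m {a<..b} (\<lambda>z. \<bar>h z\<bar>)"
      using set_integrable_abs[OF h_int] .
    define C where "C = (LINT z:{a<..b}|m. \<bar>h z\<bar>)"
    have "\<bar>J y - J t\<bar> \<le> \<bar>s y - s t\<bar> * C" for y t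
    proof -
      have "\<bar>J y - J t\<bar> \<le> (LINT z:{a<..b}|m. \<bar>s y - s t\<bar> * \<bar>h z\<bar>)"
        unfolding J_diff set_lebesgue_integral_def
      proof (rule order.trans[OF integral_abs_bound integral_mono])
        have "set_integrable m {a<..b} (\<lambda>z. (max 0 (s y - s z) - max 0 (s t - s z)) * h z)"
          using set_integral_diff(1)[OF ramp_int ramp_int] by (simp add: algebra_simps)
        then show "integrable m (\<lambda>z. \<bar>indicator {a<..b} z *\<^sub>R ((max 0 (s y - s z) - max 0 (s t - s z)) * h z)\<bar>)"
          unfolding set_integrable_def by (rule integrable_abs)
        show "integrable m (\<lambda>z. indicator {a<..b} z *\<^sub>R (\<bar>s y - s t\<bar> * \<bar>h z\<bar>))"
          using set_integrable_mult_right[of "\<bar>s y - s t\<bar>", OF norm_int] by (auto simp: set_integrable_def)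
      qed (auto simp: indicator_def abs_mult intro!: mult_right_mono)
      then show ?thesis by (simp add: C_def)
    qed
    note lip = this
    show "continuous_on {a..b} J"
      unfolding continuous_on_def
    proof
      fix t assume t: "t \<in> {a..b}"
      have "((\<lambda>y. \<bar>s y - s t\<bar> * C) \<longlongrightarrow> \<bar>s t - s t\<bar> * C) (at t within {a..b})"
        using cs t by (intro tendsto_intros) (auto simp: continuous_on_def)
      then have "((\<lambda>y. \<bar>s y - s t\<bar> * C) \<longlongrightarrow> 0) (at t within {a..b})" by simp
      then have "((\<lambda>y. J y - J t) \<longlongrightarrow> 0) (at t within {a..b})"
        by (rule Lim_null_comparison[rotated]) (auto intro: always_eventually lip)
      then show "(J \<longlongrightarrow> J t) (at t within {a..b})"
        by (simp add: LIM_zero_iff)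
    qed
  qed simp
  \<comment> \<open>Dominated convergence: the difference quotients of the ramps \<open>max 0 (s t - s z)\<close> are bounded by 1
    and tend to the indicator of \<open>z \<le> t\<close>.\<close>
  have J_deriv: "has_right_scale_deriv s J (d t - d a) t" if t: "a \<le> t" "t < b" for t
  proof -
    have "((\<lambda>y. LINT z|m. indicator {a<..b} z * ((max 0 (s y - s z) - max 0 (s t - s z)) / (s y - s t) * h z)) \<longlongrightarrow>
       (LINT z|m. indicator {a<..b} z * (indicator {..t} z * h z))) (at_right t)"
      unfolding tendsto_at_iff_sequentially comp_def
    proof safe
      fix Y :: "nat \<Rightarrow> real" assume Y: "\<forall>i. Y i \<in> {t<..} - {t}" "Y \<longlonglongrightarrow> t"
      have Y': "filterlim Y (at_right t) sequentially"
        using Y by (auto simp: filterlim_at intro: always_eventually)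
      have ev: "\<forall>\<^sub>F i in sequentially. Y i \<in> {t<..<b}"
        using eventually_compose_filterlim[OF eventually_at_right_real[OF t(2)] Y'] .
      \<comment> \<open>Strict monotonicity of \<open>s\<close> is known only up to
        \<open>b\<close>, while dominated convergence wants its bound at every index; hence the
        passage to a tail of the sequence, undone at the end by
        \<open>LIMSEQ_offset\<close>.\<close>
      then obtain N where N: "\<And>i. i \<ge> N \<Longrightarrow> Y i \<in> {t<..<b}" by (auto simp: eventually_sequentially)
      have s_less: "s t < s (Y (i + N))" for i
        using N[of "i + N"] t by (intro s_mono) auto
      define r where "r i z = (max 0 (s (Y (i + N)) - s z) - max 0 (s t - s z)) / (s (Y (i + N)) - s t)" for i z
      have r_le: "\<bar>r i z\<bar> \<le> 1" for i z
        unfolding r_def using s_less[of i] by (auto simp: abs_divide divide_le_eq)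
      \<comment> \<open>At \<open>z = t\<close> the quotient is identically 1, so an atom of
        \<open>m\<close> at \<open>t\<close> is counted in full. This matches the right-closed
        intervals \<open>{a<..t}\<close> in the hypothesis on \<open>d\<close>.\<close>
      have r_lim: "\<forall>\<^sub>F i in sequentially. r i z = indicator {..t} z" if z: "z \<in> {a<..b}" for z
      proof (cases "z \<le> t")
        case True
        then have "s z \<le> s t" using s_mono[of z t] z t by (cases "z = t") auto
        then have "r i z = 1" for i
          unfolding r_def using s_less[of i] by (simp add: max_def)
        then show ?thesis using True by (simp add: indicator_def)
      next
        case False
        have YN: "(\<lambda>i. Y (i + N)) \<longlonglongrightarrow> t" using Y(2) by (rule LIMSEQ_ignore_initial_segment)
        have "\<forall>\<^sub>F i in sequentially. Y (i + N) < z"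
          using order_tendstoD(2)[OF YN, of z] False by simp
        then show ?thesis
        proof eventually_elim
          case (elim i)
          have "s (Y (i + N)) < s z" "s t < s z"
            using elim N[of "i + N"] False z t by (auto intro!: s_mono)
          then have "max 0 (s (Y (i + N)) - s z) = 0" "max 0 (s t - s z) = 0" by auto
          then show ?case using False by (simp add: r_def)
        qed
      qed
      have "(\<lambda>i. LINT z|m. indicator {a<..b} z * (r i z * h z))
         \<longlonglongrightarrow> (LINT z|m. indicator {a<..b} z * (indicator {..t} z * h z))"
      proof (rule integral_dominated_convergence[where w = "\<lambda>z. indicator {a<..b} z * \<bar>h z\<bar>"])
        show "integrable m (\<lambda>z. indicator {a<..b} z * \<bar>h z\<bar>)"
          using set_integrable_abs[OF h_int] by (simp add: set_integrable_def)
        have "set_integrable m {a<..t} h"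
          by (rule set_integrable_subset[OF h_int]) (use t m in auto)
        moreover have "(\<lambda>z. indicator {a<..t} z *\<^sub>R h z) = (\<lambda>z. indicator {a<..b} z * (indicator {..t} z * h z))"
          using t by (auto simp: indicator_def fun_eq_iff)
        ultimately show "(\<lambda>z. indicator {a<..b} z * (indicator {..t} z * h z)) \<in> borel_measurable m"
          unfolding set_integrable_def by (metis borel_measurable_integrable)
        show "(\<lambda>z. indicator {a<..b} z * (r i z * h z)) \<in> borel_measurable m" for i
        proof -
          have "set_integrable m {a<..b} (\<lambda>z. r i z * h z)"
            unfolding r_def using s_less[of i]
            by (intro set_integrable_Ioc_if_continuous[OF m] continuous_on_mult continuous_on_divide
                continuous_on_diff continuous_on_max continuous_on_const cs h) simp
          then show ?thesis by (auto simp: set_integrable_def)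
        qed
        show "AE z in m. norm (indicator {a<..b} z * (r i z * h z)) \<le> indicator {a<..b} z * \<bar>h z\<bar>" for i
          using mult_right_mono[OF r_le abs_ge_zero] by (intro AE_I2) (auto simp: abs_mult indicator_def)
        show "AE z in m. (\<lambda>i. indicator {a<..b} z * (r i z * h z))
            \<longlonglongrightarrow> indicator {a<..b} z * (indicator {..t} z * h z)"
        proof (rule AE_I2)
          fix z
          show "(\<lambda>i. indicator {a<..b} z * (r i z * h z)) \<longlonglongrightarrow> indicator {a<..b} z * (indicator {..t} z * h z)"
          proof (cases "z \<in> {a<..b}")
            case True
            have "(\<lambda>i. r i z) \<longlonglongrightarrow> indicator {..t} z"
              using r_lim[OF True] by (rule tendsto_eventually)
            then show ?thesis by (intro tendsto_mult tendsto_const)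
          qed simp
        qed
      qed
      then have "(\<lambda>i. LINT z|m. indicator {a<..b} z * ((max 0 (s (Y (i + N)) - s z) - max 0 (s t - s z)) / (s (Y (i + N)) - s t) * h z))
         \<longlonglongrightarrow> (LINT z|m. indicator {a<..b} z * (indicator {..t} z * h z))"
        unfolding r_def .
      then show "(\<lambda>i. LINT z|m. indicator {a<..b} z * ((max 0 (s (Y i) - s z) - max 0 (s t - s z)) / (s (Y i) - s t) * h z))
         \<longlonglongrightarrow> (LINT z|m. indicator {a<..b} z * (indicator {..t} z * h z))"
        by (rule LIMSEQ_offset)
    qed
    moreover have "(LINT z|m. indicator {a<..b} z * ((max 0 (s y - s z) - max 0 (s t - s z)) / (s y - s t) * h z))
        = (J y - J t) / (s y - s t)" for y
      unfolding J_diff set_lebesgue_integral_def integral_divide_zero[symmetric]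
      by (rule Bochner_Integration.integral_cong) auto
    moreover have "(LINT z|m. indicator {a<..b} z * (indicator {..t} z * h z)) = d t - d a"
    proof (cases "t = a")
      case True
      then have "(\<lambda>z. indicator {a<..b} z * (indicator {..t} z * h z)) = (\<lambda>z. 0)"
        by (auto simp: indicator_def)
      then show ?thesis using True by (simp only: integral_zero diff_self)
    next
      case False
      then have "d t - d a = (LINT z:{a<..t}|m. h z)" using d t by auto
      also have "\<dots> = (LINT z|m. indicator {a<..b} z * (indicator {..t} z * h z))"
        unfolding set_lebesgue_integral_def
        using t by (intro Bochner_Integration.integral_cong) (auto simp: indicator_def)
      finally show ?thesis by simp
    qed
    ultimately show ?thesis unfolding has_right_scale_deriv_def by (simp only:)
  qed
  define W where "W t = F t - d a * s t - J t" for t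
  have W_const: "W y = W a" if y: "y \<in> {a..b}" for y
  proof (rule eq_if_right_scale_deriv_zero[where s = s and W = W and a = a and b = y])
    show "a \<le> y" using y by simp
    show "continuous_on {a..y} s" "strict_mono_on {a..y} s" "continuous_on {a..y} W"
      using y unfolding W_def
      by (auto intro!: continuous_intros continuous_on_subset[OF cs] monotone_on_subset[OF ms]
          continuous_on_subset[OF F] continuous_on_subset[OF J_cont])
    fix t assume t: "a \<le> t" "t < y"
    then have tb: "t < b" using y by simp
    have "((\<lambda>z. (F z - F t) / (s z - s t) - d a - (J z - J t) / (s z - s t)) \<longlongrightarrow> d t - d a - (d t - d a)) (at_right t)"
      using deriv[of t] J_deriv[of t] t tb
      by (intro tendsto_diff tendsto_const) (auto simp: has_right_scale_deriv_def)
    moreover have "\<forall>\<^sub>F z in at_right t. (F z - F t) / (s z - s t) - d a - (J z - J t) / (s z - s t)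
        = (W z - W t) / (s z - s t)"
      using eventually_at_right_real[OF tb]
    proof eventually_elim
      case (elim z)
      then have "s t < s z" using t by (intro s_mono) auto
      moreover have "W z - W t = (F z - F t) - d a * (s z - s t) - (J z - J t)"
        by (simp add: W_def algebra_simps)
      ultimately show ?case by (simp add: diff_divide_distrib)
    qed
    ultimately show "has_right_scale_deriv s W 0 t"
      unfolding has_right_scale_deriv_def using Lim_transform_eventually by force
  qed
  have "J a = 0"
  proof -
    have "max 0 (s a - s z) = 0" if "z \<in> {a<..b}" for z
      using s_mono[of a z] that by auto
    then have "(\<lambda>z. indicator {a<..b} z *\<^sub>R (max 0 (s a - s z) * h z)) = (\<lambda>z. 0)"
      by (auto simp: indicator_def fun_eq_iff)
    then show ?thesis unfolding J_def set_lebesgue_integral_def by (simp only: integral_zero)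
  qed
  have Fx: "F y = F a + d a * (s y - s a) + J y" if "y \<in> {a..b}" for y
    using W_const[OF that] \<open>J a = 0\<close> by (simp add: W_def algebra_simps)
  have sab: "s a < s b" using ab by (intro s_mono) auto
  \<comment> \<open>The weight of \<open>F b\<close> in the chord at \<open>x\<close>. Since
    \<open>q * (s b - s a) = s x - s a\<close>, the terms with \<open>d a\<close> cancel
    below.\<close>
  define q where "q = (s x - s a) / (s b - s a)"
  have "(LINT z:{a<..b}|m. chord_kernel (s a) (s b) (s x) (s z) * h z) =
     (LINT z:{a<..b}|m. q * (max 0 (s b - s z) * h z) - max 0 (s x - s z) * h z)"
  proof (rule set_lebesgue_integral_cong)
    show "\<forall>z. z \<in> {a<..b} \<longrightarrow> chord_kernel (s a) (s b) (s x) (s z) * h z =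
        q * (max 0 (s b - s z) * h z) - max 0 (s x - s z) * h z"
    proof (intro allI impI)
      fix z assume "z \<in> {a<..b}"
      then have "s z \<le> s b" using s_mono[of z b] by (cases "z = b") auto
      then show "chord_kernel (s a) (s b) (s x) (s z) * h z =
        q * (max 0 (s b - s z) * h z) - max 0 (s x - s z) * h z"
        by (simp add: chord_kernel_def q_def algebra_simps)
    qed
  qed (simp add: m)
  also have "\<dots> = q * J b - J x"
    unfolding J_def using ramp_int by (subst set_integral_diff(2)) auto
  also have "\<dots> = q * (F b - F a - d a * (s b - s a)) - (F x - F a - d a * (s x - s a))"
    using Fx[of b] Fx[of x] ab by (simp add: algebra_simps)
  also have "\<dots> = (1 - q) * F a + q * F b - F x - d a * (q * (s b - s a) - (s x - s a))"
    by (simp add: algebra_simps)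
  also have "q * (s b - s a) = s x - s a" using sab by (simp add: q_def)
  also have "1 - q = (s b - s x) / (s b - s a)" using sab by (simp add: q_def field_simps)
  finally show ?thesis by (simp add: q_def)
qed

section \<open>Comparing densities through continuous test functions\<close>

text \<open>The generator is described only on resolvents of continuous functions, so inequalities
  between densities are accessible only through continuous \<open>u\<close>. Such \<open>u\<close>
  increase to the indicator of an open set, which compares the finite measures with densities
  \<open>A\<close> and \<open>B\<close> on open sets; outer regularity of the second one carries
  this over to the Borel set where \<open>B < A\<close>, and there it forces
  \<open>m\<close>-measure 0.\<close>

lemma AE_le_if_integral_continuous_le:
  fixes A B :: "real \<Rightarrow> real"
  assumes m: "sets m = sets borel" and A: "integrable m A" and B: "integrable m B"
    and nonneg: "\<And>y. 0 \<le> A y" "\<And>y. 0 \<le> B y"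
    and le: "\<And>u. continuous_on UNIV u \<Longrightarrow> (\<And>y. 0 \<le> u y) \<Longrightarrow> (\<And>y. u y \<le> 1) \<Longrightarrow>
      (LINT y|m. A y * u y) \<le> (LINT y|m. B y * u y)"
  shows "AE y in m. A y \<le> B y"
proof -
  have space_m: "space m = UNIV" using sets_eq_imp_space_eq[OF m] by simp
  have [measurable]: "A \<in> borel_measurable m" "B \<in> borel_measurable m" using A B by auto
  have int_ind: "integrable m (\<lambda>y. C y * indicator E y)" if "integrable m C" "E \<in> sets m" for C :: "real \<Rightarrow> real" and E
    using integrable_mult_indicator[OF that(2,1)] by (simp add: mult.commute)
  \<comment> \<open>The distance to the empty set is 0 by convention, so these functions would
    vanish for \<open>U = UNIV\<close>; that case is tested with the constant 1 instead.\<close>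
  have lim: "(\<lambda>n. LINT y|m. C y * min 1 (real n * infdist y (- U))) \<longlonglongrightarrow> (LINT y|m. C y * indicator U y)"
    if C: "integrable m C" and U: "open U" "U \<noteq> UNIV" for C :: "real \<Rightarrow> real" and U
  proof (rule integral_dominated_convergence[where w = "\<lambda>y. \<bar>C y\<bar>"])
    have [measurable]: "C \<in> borel_measurable m" "U \<in> sets m" using C U m by auto
    have "(\<lambda>y. min 1 (real n * infdist y (- U))) \<in> borel_measurable borel" for n
      by (intro borel_measurable_continuous_onI continuous_intros)
    then have [measurable]: "(\<lambda>y. min 1 (real n * infdist y (- U))) \<in> borel_measurable m" for n
      by (simp cong: measurable_cong_sets add: m)
    show "(\<lambda>y. C y * indicator U y) \<in> borel_measurable m"
      "(\<lambda>y. C y * min 1 (real n * infdist y (- U))) \<in> borel_measurable m" for n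
      by measurable
    show "AE y in m. norm (C y * min 1 (real n * infdist y (- U))) \<le> \<bar>C y\<bar>" for n
    proof (rule AE_I2)
      fix y
      have "\<bar>min 1 (real n * infdist y (- U))\<bar> \<le> 1" by (simp add: infdist_nonneg)
      from mult_left_mono[OF this abs_ge_zero[of "C y"]]
      show "norm (C y * min 1 (real n * infdist y (- U))) \<le> \<bar>C y\<bar>" by (simp add: abs_mult)
    qed
    show "AE y in m. (\<lambda>n. C y * min 1 (real n * infdist y (- U))) \<longlonglongrightarrow> C y * indicator U y"
    proof (rule AE_I2)
      fix y
      have "(\<lambda>n. min 1 (real n * infdist y (- U))) \<longlonglongrightarrow> indicator U y"
      proof (cases "y \<in> U")
        case True
        then have "0 < infdist y (- U)" using U by (intro infdist_pos_not_in_closed) auto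
        then obtain N where N: "1 < real N * infdist y (- U)"
          using reals_Archimedean3 by blast
        have "min 1 (real n * infdist y (- U)) = 1" if "n \<ge> N" for n
          using N mult_right_mono[of "real N" "real n" "infdist y (- U)"] that by (auto simp: infdist_nonneg)
        then show ?thesis using True
          by (intro tendsto_eventually) (auto simp: eventually_sequentially)
      qed simp
      then show "(\<lambda>n. C y * min 1 (real n * infdist y (- U))) \<longlonglongrightarrow> C y * indicator U y"
        by (intro tendsto_mult tendsto_const)
    qed
  qed (use C in auto)
  have open_le: "(LINT y|m. A y * indicator U y) \<le> (LINT y|m. B y * indicator U y)" if "open U" for U
  proof (cases "U = UNIV")
    case True
    then show ?thesis using le[of "\<lambda>_. 1"] by simp
  next
    case False
    show ?thesis
      by (rule LIMSEQ_le[OF lim[OF A that False] lim[OF B that False]])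
        (auto intro!: exI[of _ 0] le continuous_intros simp: infdist_nonneg)
  qed
  have emeasure_C: "emeasure (density m C) E = ennreal (LINT y|m. C y * indicator E y)"
    if "integrable m C" "\<And>y. 0 \<le> C y" "E \<in> sets m" for C :: "real \<Rightarrow> real" and E
  proof -
    have "emeasure (density m C) E = (\<integral>\<^sup>+y. ennreal (C y * indicator E y) \<partial>m)"
      using that by (subst emeasure_density) (auto simp: ennreal_mult' ennreal_indicator intro!: nn_integral_cong)
    also have "\<dots> = ennreal (LINT y|m. C y * indicator E y)"
      using that by (intro nn_integral_eq_integral int_ind) auto
    finally show ?thesis .
  qed
  define E where "E = {y. B y < A y}"
  have E: "E \<in> sets m"
    using borel_measurable_less[of B m A] by (simp add: E_def space_m)
  have "emeasure (density m A) E \<le> (INF U \<in> {U. E \<subseteq> U \<and> open U}. emeasure (density m B) U)"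
  proof (rule INF_greatest, safe)
    fix U :: "real set" assume U: "E \<subseteq> U" "open U"
    then have Um: "U \<in> sets m" by (simp add: m)
    have "emeasure (density m A) E \<le> emeasure (density m A) U"
      using U Um by (intro emeasure_mono) auto
    also have "\<dots> \<le> emeasure (density m B) U"
      using open_le[OF U(2)] by (simp add: emeasure_C A B nonneg Um ennreal_leI)
    finally show "emeasure (density m A) E \<le> emeasure (density m B) U" .
  qed
  also have "\<dots> = emeasure (density m B) E"
  proof (rule outer_regular[symmetric])
    show "sets (density m B) = sets borel" by (simp add: m)
    show "emeasure (density m B) (space (density m B)) \<noteq> \<infinity>"
      by (simp add: emeasure_C B nonneg)
    show "E \<in> sets borel" using E m by simp
  qed
  finally have "(LINT y|m. A y * indicator E y) \<le> (LINT y|m. B y * indicator E y)"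
    using nonneg by (simp add: emeasure_C A B nonneg E)
  then have "(LINT y|m. (A y - B y) * indicator E y) \<le> 0"
    using int_ind[OF A E] int_ind[OF B E] by (simp add: left_diff_distrib)
  moreover have pos: "0 \<le> (A y - B y) * indicator E y" for y
    by (auto simp: E_def indicator_def)
  ultimately have "(LINT y|m. (A y - B y) * indicator E y) = 0"
    by (intro antisym integral_nonneg_AE) auto
  then have "AE y in m. (A y - B y) * indicator E y = 0"
    using int_ind[OF _ E, of "\<lambda>y. A y - B y"] A B pos by (subst (asm) integral_nonneg_eq_0_iff_AE) auto
  then show ?thesis
    by eventually_elim (auto simp: E_def indicator_def split: if_splits)
qed

section \<open>The resolvent as an integral operator\<close>

lemma (in diffusion) sigma_finite_if_finite_on_Icc:
  assumes m: "sets m = sets borel" "emeasure m (- I) = 0"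
    and fin: "\<forall>a\<in>I. \<forall>b\<in>I. emeasure m {a..b} < \<top>"
  shows "sigma_finite_measure m"
proof
  \<comment> \<open>The endpoints of \<open>I\<close> that belong to \<open>I\<close>, at most two.
    Intervals with rational endpoints in \<open>I\<close> cover the other points of \<open>I\<close>
    but may miss these, which are therefore added to \<open>K\<close> as singletons.\<close>
  define E where "E = {e \<in> I. (\<forall>y\<in>I. e \<le> y) \<or> (\<forall>y\<in>I. y \<le> e)}"
  define K where "K = {- I} \<union> (\<lambda>(a, b). {a..b}) ` ((I \<inter> \<rat>) \<times> (I \<inter> \<rat>)) \<union> (\<lambda>e. {e..e}) ` E"
  have "E \<subseteq> {Inf I, Sup I}"
    by (auto simp: E_def intro: cInf_eq_minimum[symmetric] cSup_eq_maximum[symmetric])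
  then have "countable E" by (auto intro: countable_finite finite_subset)
  moreover have "countable (I \<inter> \<rat>)" by (rule countable_Int2[OF countable_rat])
  ultimately have "countable K" unfolding K_def by auto
  have I_borel: "I \<in> sets borel"
    using interval(1) by (rule real_interval_borel_measurable)
  have mid: "\<exists>q\<in>I \<inter> \<rat>. a \<le> q \<and> q \<le> b" if "a \<in> I" "b \<in> I" "a < b" for a b
  proof -
    obtain q where "q \<in> \<rat>" "a < q" "q < b" using Rats_dense_in_real[OF \<open>a < b\<close>] by auto
    moreover have "q \<in> I"
      by (rule mem_is_interval_1_I[OF interval(1) that(1,2)]) (use calculation in auto)
    ultimately show ?thesis by (intro bexI[of _ q]) auto
  qed
  have "x \<in> \<Union> K" for x
  proof (cases "x \<in> I \<and> x \<notin> E")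
    case True
    then obtain y z where "y \<in> I" "y < x" "z \<in> I" "x < z" by (auto simp: E_def not_le)
    with True mid[of y x] mid[of x z] obtain a b where "a \<in> I \<inter> \<rat>" "a \<le> x" "b \<in> I \<inter> \<rat>" "x \<le> b" by auto
    then have "{a..b} \<in> K" "x \<in> {a..b}" by (auto simp: K_def)
    then show ?thesis by blast
  qed (auto simp: K_def)
  then have "\<Union> K = space m" using sets_eq_imp_space_eq[OF m(1)] by auto
  moreover have "K \<subseteq> sets m" using I_borel by (auto simp: K_def m)
  moreover have "emeasure m {e} < \<top>" if "e \<in> I" for e
    using fin that by (metis atLeastAtMost_singleton)
  then have "\<forall>a\<in>K. emeasure m a \<noteq> \<infinity>" using m fin by (auto simp: K_def E_def less_top)
  ultimately show "\<exists>A. countable A \<and> A \<subseteq> sets m \<and> \<Union> A = space m \<and> (\<forall>a\<in>A. emeasure m a \<noteq> \<infinity>)"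
    using \<open>countable K\<close> by blast
qed

text \<open>The density of the resolvent measure with respect to \<open>m\<close>. A transition
  density is unconstrained for \<open>y\<close> outside \<open>I\<close>; with the cut-off,
  integrals can run over the whole line.\<close>

definition resolvent_kernel :: "real set \<Rightarrow> (real \<Rightarrow> real \<Rightarrow> real \<Rightarrow> real) \<Rightarrow> real \<Rightarrow> real \<Rightarrow> real \<Rightarrow> real" where
  "resolvent_kernel I p \<alpha> x y = indicator I y * Green_function p \<alpha> x y"

lemma resolvent_kernel_nonneg:
  assumes "transition_density I \<Omega> X P m p" "x \<in> I"
  shows "0 \<le> resolvent_kernel I p \<alpha> x y"
proof (cases "y \<in> I")
  case True
  then show ?thesis using assms
    unfolding resolvent_kernel_def Green_function_def set_lebesgue_integral_def transition_density_def
    by (intro mult_nonneg_nonneg integral_nonneg_AE AE_I2) (auto simp: indicator_def)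
qed (simp add: resolvent_kernel_def)

text \<open>Fubini in time and space. For \<open>t > 0\<close> the law of \<open>X t\<close> has
  density \<open>p t x\<close>, of total mass 1, so the double integral of
  \<open>exp (- \<alpha> * t) * p t x y\<close> is finite.\<close>

lemma (in diffusion) resolvent_eq_integral_kernel:
  assumes td: "transition_density I \<Omega> X P m p" and m: "sets m = sets borel" "sigma_finite_measure m"
    and x: "x \<in> I" and "\<alpha> > 0"
  shows "integrable m (resolvent_kernel I p \<alpha> x)"
    and "continuous_on UNIV u \<Longrightarrow> (\<And>y. \<bar>u y\<bar> \<le> 1) \<Longrightarrow>
      resolvent X P \<alpha> u x = (LINT y|m. resolvent_kernel I p \<alpha> x y * u y)"
proof -
  interpret m: sigma_finite_measure m by fact
  interpret pair_sigma_finite lborel m ..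
  have I_borel: "I \<in> sets borel"
    using interval(1) by (rule real_interval_borel_measurable)
  have "P x \<in> space (prob_algebra (natural_filtration \<Omega> X \<top>))"
    using measurable_space[OF kernel] x by (simp add: space_restrict_space)
  then have Px: "sets (P x) = sets (natural_filtration \<Omega> X \<top>)" "prob_space (P x)"
    by (auto simp: space_prob_algebra)
  interpret Px: prob_space "P x" by fact
  have space_nf: "space (natural_filtration \<Omega> X \<top>) = \<Omega>"
    unfolding natural_filtration_def by (auto intro!: space_measure_of)
  have space_Px: "space (P x) = \<Omega>" using sets_eq_imp_space_eq[OF Px(1)] space_nf by simp
  have X_meas: "X t \<in> borel_measurable (P x)" if "0 \<le> t" for t
  proof (rule measurableI)
    fix B :: "real set" assume "B \<in> sets borel"
    then have "X t -` B \<inter> \<Omega> \<in> sets (natural_filtration \<Omega> X \<top>)"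
      unfolding natural_filtration_def using that
      by (subst sets_measure_of) (auto intro!: sigma_sets.Basic)
    then show "X t -` B \<inter> space (P x) \<in> sets (P x)" by (simp add: space_Px Px)
  qed simp
  \<comment> \<open>The density for the fixed starting point \<open>x\<close>, extended by 0 so that
    it is jointly measurable on the whole product space; measurability of \<open>p\<close> is given
    only on the restricted space.\<close>
  define q where "q = (\<lambda>(t, y). indicator ({0<..} \<times> I) (t, y) * p t x y)"
  have q_nonneg: "0 \<le> q (t, y)" for t y
    using td x by (auto simp: q_def transition_density_def indicator_def)
  have q_meas [measurable]: "q \<in> borel_measurable (lborel \<Otimes>\<^sub>M m)"
  proof -
    define S where "S = {0::real<..} \<times> I \<times> I"
    have S: "S \<in> sets borel"
      unfolding S_def borel_prod[symmetric] using I_borel by (intro pair_measureI) auto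
    have "(\<lambda>(t, x, y). p t x y) \<in> borel_measurable (restrict_space borel S)"
      using td by (simp add: transition_density_def S_def)
    then have "(\<lambda>z. indicator S z *\<^sub>R (case z of (t, x, y) \<Rightarrow> p t x y)) \<in> borel_measurable borel"
      using S by (subst (asm) borel_measurable_restrict_space_iff) auto
    moreover have "(\<lambda>(t, y). (t, x, y)) \<in> lborel \<Otimes>\<^sub>M m \<rightarrow>\<^sub>M borel"
      unfolding borel_prod[symmetric]
      by (simp add: split_beta' m cong: measurable_cong_sets sets_pair_measure_cong) measurable
    ultimately have "(\<lambda>z. indicator S z *\<^sub>R (case z of (t, x, y) \<Rightarrow> p t x y)) \<circ> (\<lambda>(t, y). (t, x, y))
        \<in> borel_measurable (lborel \<Otimes>\<^sub>M m)"
      by (rule measurable_comp[rotated])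
    moreover have "(\<lambda>z. indicator S z *\<^sub>R (case z of (t, x, y) \<Rightarrow> p t x y)) \<circ> (\<lambda>(t, y). (t, x, y)) = q"
      using x by (auto simp: fun_eq_iff q_def S_def indicator_def)
    ultimately show ?thesis by simp
  qed
  have q_section [measurable]: "(\<lambda>y. q (t, y)) \<in> borel_measurable m" for t
    by measurable
  have law: "distr (P x) borel (X t) = density m (\<lambda>y. q (t, y))" if "0 < t" for t
  proof (rule measure_eqI)
    show "sets (distr (P x) borel (X t)) = sets (density m (\<lambda>y. q (t, y)))" by (simp add: m)
    fix B assume "B \<in> sets (distr (P x) borel (X t))"
    then have B: "B \<in> sets borel" by simp
    have "emeasure (distr (P x) borel (X t)) B = emeasure (P x) {\<omega> \<in> \<Omega>. X t \<omega> \<in> B}"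
      using that B by (subst emeasure_distr) (auto simp: X_meas space_Px vimage_def Int_def conj_commute)
    also have "\<dots> = (\<integral>\<^sup>+ y \<in> B \<inter> I. ennreal (p t x y) \<partial>m)"
      using td x B that by (simp add: transition_density_def)
    also have "\<dots> = emeasure (density m (\<lambda>y. q (t, y))) B"
      using B that q_section[of t]
      by (subst emeasure_density) (simp_all add: m, auto simp: q_def indicator_def intro!: nn_integral_cong)
    finally show "emeasure (distr (P x) borel (X t)) B = emeasure (density m (\<lambda>y. q (t, y))) B" .
  qed
  have expect: "(LINT \<omega>|P x. v (X t \<omega>)) = (LINT y|m. q (t, y) * v y)"
    if "0 < t" "v \<in> borel_measurable borel" for t and v :: "real \<Rightarrow> real"
  proof -
    have "(LINT \<omega>|P x. v (X t \<omega>)) = (LINT y|distr (P x) borel (X t). v y)"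
      using that X_meas[of t] by (subst integral_distr) auto
    also have "\<dots> = (LINT y|m. q (t, y) * v y)"
      unfolding law[OF that(1)] using that(2) q_nonneg measurable_cong_sets[OF m(1) refl, of borel]
      by (subst integral_density) auto
    finally show ?thesis .
  qed
  have q_int: "integrable m (\<lambda>y. q (t, y))" for t
  proof (cases "0 < t")
    case True
    have "emeasure (density m (\<lambda>y. q (t, y))) (space m) = 1"
      using True Px.prob_space_axioms X_meas[of t] prob_space.emeasure_space_1[OF Px.prob_space_distr[OF X_meas]]
        law[OF True] by (metis less_imp_le space_density)
    then have "(\<integral>\<^sup>+y. ennreal (q (t, y)) \<partial>m) = 1"
      by (subst (asm) emeasure_density) (auto cong: nn_integral_cong)
    then show ?thesis using q_nonneg by (intro integrableI_nonneg) auto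
  next
    case False
    then have "(\<lambda>y. q (t, y)) = (\<lambda>y. 0)" by (auto simp: q_def)
    then show ?thesis by simp
  qed
  have q_total: "(LINT y|m. q (t, y)) = indicator {0<..} t" for t
  proof (cases "0 < t")
    case True
    then show ?thesis using expect[of t "\<lambda>_. 1"] Px.prob_space by simp
  qed (simp add: q_def)
  define k where "k = (\<lambda>(t, y). exp (- \<alpha> * t) * q (t, y))"
  have k_meas [measurable]: "k \<in> borel_measurable (lborel \<Otimes>\<^sub>M m)"
    unfolding k_def by measurable
  have k_int: "integrable (lborel \<Otimes>\<^sub>M m) k"
  proof (rule Fubini_integrable)
    have "(LINT y|m. norm (k (t, y))) = indicator {0<..} t *\<^sub>R exp (- (t * \<alpha>))" for t
      using q_nonneg by (simp add: k_def abs_mult q_total mult.commute)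
    then show "integrable lborel (\<lambda>t. LINT y|m. norm (k (t, y)))"
      using integrable_I0i_exp_mscale[OF \<open>\<alpha> > 0\<close>] by (simp add: set_integrable_def)
    show "AE t in lborel. integrable m (\<lambda>y. k (t, y))"
      by (simp add: k_def q_int)
  qed fact
  have kernel_eq: "resolvent_kernel I p \<alpha> x y = (LINT t|lborel. k (t, y))" for y
    by (cases "y \<in> I")
      (auto simp: resolvent_kernel_def Green_function_def set_lebesgue_integral_def k_def q_def indicator_times
        intro!: Bochner_Integration.integral_cong)
  show "integrable m (resolvent_kernel I p \<alpha> x)"
    unfolding kernel_eq[abs_def] by (rule integrable_snd) (use k_int in simp)
  show "resolvent X P \<alpha> u x = (LINT y|m. resolvent_kernel I p \<alpha> x y * u y)"
    if u: "continuous_on UNIV u" "\<And>y. \<bar>u y\<bar> \<le> 1" for u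
  proof -
    have u_meas [measurable]: "u \<in> borel_measurable borel" using u by (intro borel_measurable_continuous_onI)
    then have [measurable]: "u \<in> borel_measurable m" by (simp cong: measurable_cong_sets add: m)
    have ku_int: "integrable (lborel \<Otimes>\<^sub>M m) (\<lambda>(t, y). k (t, y) * u y)"
    proof (rule Bochner_Integration.integrable_bound[OF k_int])
      show "AE z in lborel \<Otimes>\<^sub>M m. norm (case z of (t, y) \<Rightarrow> k (t, y) * u y) \<le> norm (k z)"
        using u(2) by (intro AE_I2) (simp add: abs_mult mult_left_le split: prod.split)
    qed measurable
    have "resolvent X P \<alpha> u x = (LINT t|lborel. LINT y|m. k (t, y) * u y)"
      unfolding resolvent_def set_lebesgue_integral_def
    proof (rule integral_cong_AE)
      show "(\<lambda>t. LINT y|m. k (t, y) * u y) \<in> borel_measurable lborel"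
        using integrable_fst'[OF ku_int] by simp
      \<comment> \<open>The resolvent integrates over \<open>{0..}\<close> and the Green function
        over \<open>{0<..}\<close>. At \<open>t = 0\<close> the law of \<open>X t\<close> need not
        have a density, and the two integrands may differ there; a single time is a null
        set.\<close>
      have eq: "indicator {0..} t *\<^sub>R (exp (- \<alpha> * t) * (LINT \<omega>|P x. u (X t \<omega>))) = (LINT y|m. k (t, y) * u y)"
        if "t \<noteq> 0" for t
        using that by (cases "t > 0") (auto simp: expect k_def q_def mult.assoc)
      show "AE t in lborel. indicator {0..} t *\<^sub>R (exp (- \<alpha> * t) * (LINT \<omega>|P x. u (X t \<omega>))) = (LINT y|m. k (t, y) * u y)"
        using AE_lborel_singleton[of 0] by eventually_elim (rule eq)
      have "(\<lambda>t. indicator {0..} t *\<^sub>R (exp (- \<alpha> * t) * (LINT \<omega>|P x. u (X t \<omega>)))) =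
          (\<lambda>t. if t = 0 then LINT \<omega>|P x. u (X 0 \<omega>) else LINT y|m. k (t, y) * u y)"
        using eq by (auto simp: fun_eq_iff)
      also have "\<dots> \<in> borel_measurable lborel"
        using integrable_fst'[OF ku_int] by (intro measurable_If) auto
      finally show "(\<lambda>t. indicator {0..} t *\<^sub>R (exp (- \<alpha> * t) * (LINT \<omega>|P x. u (X t \<omega>)))) \<in> borel_measurable lborel" .
    qed
    also have "\<dots> = (LINT y|m. LINT t|lborel. k (t, y) * u y)"
      using Fubini_integral[of "\<lambda>t y. k (t, y) * u y"] ku_int by simp
    also have "\<dots> = (LINT y|m. resolvent_kernel I p \<alpha> x y * u y)"
      by (simp add: kernel_eq)
    finally show ?thesis .
  qed
qed

section \<open>Harnack inequality and chord estimates on a small interval\<close>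

text \<open>Here \<open>F\<close> stands for the resolvent of \<open>u\<close>. The last two
  estimates bound the difference of the two difference quotients of \<open>F\<close> at
  \<open>x\<close>, towards \<open>b\<close> and towards \<open>a\<close>, from above and below.
  They are expanded so that both sides have nonnegative coefficients, as the comparison of densities
  requires, and so that \<open>F\<close> enters only at \<open>a\<close>, \<open>x\<close> and
  \<open>b\<close>.\<close>

lemma chord_estimates:
  fixes F u s d :: "real \<Rightarrow> real" and m :: "real measure"
  assumes m: "sets m = sets borel" "emeasure m {a0..b0} < \<top>"
    and x: "a0 < x" "x < b0" and mid: "s a0 = s x - h" "s b0 = s x + h"
    and cs: "continuous_on {a0..b0} s" and ms: "strict_mono_on {a0..b0} s"
    and F: "continuous_on {a0..b0} F" "\<And>z. z \<in> {a0..b0} \<Longrightarrow> 0 \<le> F z"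
    and u: "continuous_on {a0..b0} u" "\<And>z. z \<in> {a0..b0} \<Longrightarrow> 0 \<le> u z"
    and deriv: "\<And>t. t \<in> {a0..b0} \<Longrightarrow> has_right_scale_deriv s F (d t) t"
    and d: "\<And>y z. a0 \<le> y \<Longrightarrow> y < z \<Longrightarrow> z \<le> b0 \<Longrightarrow> d z - d y = (LINT t:{y<..z}|m. \<alpha> * F t - u t)"
    and \<alpha>: "0 < \<alpha>" "\<alpha> * (2 * h) * measure m {a0..b0} \<le> 1 / 8"
  shows chord_estimates_center: "\<And>c1 c2. a0 \<le> c1 \<Longrightarrow> c2 \<le> b0 \<Longrightarrow> (\<And>z. z \<in> {c1<..c2} \<Longrightarrow> \<bar>s z - s x\<bar> \<le> h / 2) \<Longrightarrow>
      (LINT z:{c1<..c2}|m. u z) \<le> 8 / h * F x"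
    and chord_estimates_upper: "\<And>a b. a0 \<le> a \<Longrightarrow> a < x \<Longrightarrow> x < b \<Longrightarrow> b \<le> b0 \<Longrightarrow>
      F b / (s b - s x) + F a / (s x - s a)
        \<le> (3 * \<alpha> * measure m {a<..b} + 1 / (s b - s x) + 1 / (s x - s a)) * F x"
    and chord_estimates_lower: "\<And>a b. a0 \<le> a \<Longrightarrow> a < x \<Longrightarrow> x < b \<Longrightarrow> b \<le> b0 \<Longrightarrow>
      (1 / (s b - s x) + 1 / (s x - s a)) * F x
        \<le> F b / (s b - s x) + F a / (s x - s a) + (LINT z:{a<..b}|m. u z)"
proof -
  have s_less: "s y < s z" if "a0 \<le> y" "y < z" "z \<le> b0" for y z
    using that by (intro strict_mono_onD[OF ms]) auto
  have s_le: "s y \<le> s z" if "a0 \<le> y" "y \<le> z" "z \<le> b0" for y z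
    using that s_less[of y z] by (cases "y = z") auto
  have h: "0 < h" using s_less[of a0 x] x mid by simp
  have int: "set_integrable m {a<..b} k" if "a0 \<le> a" "b \<le> b0" "continuous_on {a0..b0} k" for a b and k :: "real \<Rightarrow> real"
    by (rule set_integrable_subset[OF set_integrable_Ioc_if_continuous[OF m that(3)]]) (use m that in auto)
  have cont_kernel: "continuous_on {a0..b0} (\<lambda>z. chord_kernel A B y (s z) * k z)"
    if "continuous_on {a0..b0} k" for A B y and k :: "real \<Rightarrow> real"
    unfolding chord_kernel_def by (intro continuous_intros cs that)
  have meas_le: "measure m {a<..b} \<le> measure m {a0..b0}" if "a0 \<le> a" "b \<le> b0" for a b
    using m that by (intro measure_mono_fmeasurable) (auto simp: fmeasurable_def)
  have int_const: "(LINT z:{a<..b}|m. c) = c * measure m {a<..b}" for a b c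
    using sets_eq_imp_space_eq[OF m(1)] by (simp add: set_lebesgue_integral_def)
  have chord: "(s b - s y) / (s b - s a) * F a + (s y - s a) / (s b - s a) * F b - F y =
      \<alpha> * (LINT z:{a<..b}|m. chord_kernel (s a) (s b) (s y) (s z) * F z)
      - (LINT z:{a<..b}|m. chord_kernel (s a) (s b) (s y) (s z) * u z)"
    if "a0 \<le> a" "a < b" "b \<le> b0" "y \<in> {a..b}" for a b y
  proof -
    have sub: "{a..b} \<subseteq> {a0..b0}" using that by auto
    have "(s b - s y) / (s b - s a) * F a + (s y - s a) / (s b - s a) * F b - F y =
        (LINT z:{a<..b}|m. chord_kernel (s a) (s b) (s y) (s z) * (\<alpha> * F z - u z))"
    proof (rule chord_equation[where d = d, OF m(1) _ that(2,4)])
      show "emeasure m {a..b} < \<top>"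
        by (rule le_less_trans[OF emeasure_mono m(2)]) (use m sub in auto)
      show "continuous_on {a..b} s" "strict_mono_on {a..b} s" "continuous_on {a..b} F"
        "continuous_on {a..b} (\<lambda>z. \<alpha> * F z - u z)"
        using sub by (auto intro!: continuous_intros intro: continuous_on_subset[OF cs] monotone_on_subset[OF ms]
            continuous_on_subset[OF F(1)] continuous_on_subset[OF u(1)])
    qed (use deriv d that in auto)
    also have "\<dots> = (LINT z:{a<..b}|m. \<alpha> * (chord_kernel (s a) (s b) (s y) (s z) * F z)
        - chord_kernel (s a) (s b) (s y) (s z) * u z)"
      by (simp add: algebra_simps)
    also have "\<dots> = \<alpha> * (LINT z:{a<..b}|m. chord_kernel (s a) (s b) (s y) (s z) * F z)
      - (LINT z:{a<..b}|m. chord_kernel (s a) (s b) (s y) (s z) * u z)"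
      using that by (subst set_integral_diff(2)) (auto intro!: int cont_kernel F u set_integrable_mult_right)
    finally show ?thesis .
  qed
  have kernel_nonneg: "0 \<le> chord_kernel (s a) (s b) (s y) (s z)"
    if "a0 \<le> a" "a < b" "b \<le> b0" "y \<in> {a..b}" "z \<in> {a<..b}" for a b y z
    using that by (intro chord_kernel_bounds s_less s_le) auto
  have kernel_mid: "chord_kernel (s a0) (s b0) (s x) (s z) = (h - \<bar>s z - s x\<bar>) / 2" for z
    using chord_kernel_midpoint[OF h] mid by simp
  \<comment> \<open>Two of the kernel bounds together give the minimum of the scale distances from
    \<open>z\<close> to the two ends. As the interval is centred at \<open>x\<close> in the scale,
    this minimum is \<open>h - \<bar>s z - s x\<bar>\<close>, exactly twice the kernel at the
    centre.\<close>
  have kernel_le_mid: "chord_kernel (s a0) (s b0) (s y) (s z) \<le> 2 * chord_kernel (s a0) (s b0) (s x) (s z)"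
    if "y \<in> {a0..b0}" "z \<in> {a0<..b0}" for y z
  proof -
    have "chord_kernel (s a0) (s b0) (s y) (s z) \<le> s z - s a0" "chord_kernel (s a0) (s b0) (s y) (s z) \<le> s b0 - s z"
      using that x by (intro chord_kernel_bounds s_less s_le; auto)+
    then show ?thesis unfolding kernel_mid using mid by (auto simp: abs_if)
  qed
  \<comment> \<open>Harnack: the maximum \<open>F z0\<close> and \<open>F x\<close> are compared through the chord over the whole interval,
    whose kernel at the midpoint dominates half of every other kernel.\<close>
  obtain z0 where z0: "z0 \<in> {a0..b0}" and sup: "\<And>z. z \<in> {a0..b0} \<Longrightarrow> F z \<le> F z0"
    using continuous_attains_sup[OF _ _ F(1)] x by fastforce
  define U where "U y = (LINT z:{a0<..b0}|m. chord_kernel (s a0) (s b0) (s y) (s z) * u z)" for y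
  define W where "W y = (LINT z:{a0<..b0}|m. chord_kernel (s a0) (s b0) (s y) (s z) * F z)" for y
  have W_nonneg: "0 \<le> W y" if "y \<in> {a0..b0}" for y
    unfolding W_def set_lebesgue_integral_def using that x kernel_nonneg[of a0 b0 y] F(2)
    by (intro integral_nonneg_AE AE_I2) (auto simp: indicator_def)
  have F0: "0 \<le> F a0" "0 \<le> F b0" "0 \<le> F z0" using F(2) x z0 by auto
  have "F z0 \<le> F a0 + F b0 + U z0"
  proof -
    have "(s b0 - s z0) / (s b0 - s a0) * F a0 + (s z0 - s a0) / (s b0 - s a0) * F b0 - F z0 = \<alpha> * W z0 - U z0"
      unfolding U_def W_def using x z0 by (intro chord) auto
    moreover have "(s b0 - s z0) / (s b0 - s a0) \<le> 1" "(s z0 - s a0) / (s b0 - s a0) \<le> 1"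
      using z0 s_le[of a0 z0] s_le[of z0 b0] s_less[of a0 b0] x by (auto simp: divide_le_eq)
    then have "(s b0 - s z0) / (s b0 - s a0) * F a0 \<le> F a0" "(s z0 - s a0) / (s b0 - s a0) * F b0 \<le> F b0"
      using F0 by (metis mult_1 mult_right_mono)+
    moreover have "0 \<le> \<alpha> * W z0" using W_nonneg[OF z0] \<alpha> by simp
    ultimately show ?thesis by linarith
  qed
  moreover have "U z0 \<le> 2 * U x"
  proof -
    have "U z0 \<le> (LINT z:{a0<..b0}|m. 2 * (chord_kernel (s a0) (s b0) (s x) (s z) * u z))"
      unfolding U_def
    proof (rule set_integral_mono)
      fix z assume z: "z \<in> {a0<..b0}"
      show "chord_kernel (s a0) (s b0) (s z0) (s z) * u z \<le> 2 * (chord_kernel (s a0) (s b0) (s x) (s z) * u z)"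
        using mult_right_mono[OF kernel_le_mid[OF z0 z], of "u z"] u(2)[of z] z by simp
    qed (auto intro!: int cont_kernel u set_integrable_mult_right)
    then show ?thesis by (simp add: U_def)
  qed
  moreover have center: "F x = (F a0 + F b0) / 2 + U x - \<alpha> * W x"
  proof -
    have "(s b0 - s x) / (s b0 - s a0) * F a0 + (s x - s a0) / (s b0 - s a0) * F b0 - F x = \<alpha> * W x - U x"
      unfolding U_def W_def using x by (intro chord) auto
    moreover have "(s b0 - s x) / (s b0 - s a0) = 1 / 2" "(s x - s a0) / (s b0 - s a0) = 1 / 2"
      using h mid by auto
    ultimately show ?thesis by (simp add: algebra_simps add_divide_distrib)
  qed
  moreover have W_small: "\<alpha> * W x \<le> F z0 / 8"
  proof -
    have "W x \<le> (LINT z:{a0<..b0}|m. (2 * h) * F z0)"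
      unfolding W_def
    proof (rule set_integral_mono)
      fix z assume z: "z \<in> {a0<..b0}"
      have "chord_kernel (s a0) (s b0) (s x) (s z) \<le> 2 * h" using h by (simp add: kernel_mid)
      then show "chord_kernel (s a0) (s b0) (s x) (s z) * F z \<le> 2 * h * F z0"
        using z x F(2)[of z] sup[of z] kernel_nonneg[of a0 b0 x z] h by (intro mult_mono) auto
    qed (auto intro!: int cont_kernel F continuous_intros)
    also have "\<dots> \<le> 2 * h * F z0 * measure m {a0..b0}"
      unfolding int_const using h F0 meas_le by (intro mult_left_mono) auto
    finally have "\<alpha> * W x \<le> \<alpha> * (2 * h * F z0 * measure m {a0..b0})"
      using \<alpha> by (intro mult_left_mono) auto
    also have "\<dots> = (\<alpha> * (2 * h) * measure m {a0..b0}) * F z0" by simp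
    also have "\<dots> \<le> 1 / 8 * F z0" using \<alpha> F0 by (intro mult_right_mono) auto
    finally show ?thesis by simp
  qed
  \<comment> \<open>\<open>F z0 \<le> F a0 + F b0 + 2 * U x = 2 * (F x + \<alpha> * W x) \<le> 2 * F
    x + F z0 / 4\<close>, so \<open>F z0\<close> is at most 8/3 times \<open>F x\<close>. The
    smallness condition with 1/8 is what lets the last term be absorbed.\<close>
  ultimately have harnack: "F z0 \<le> 3 * F x" using F0 by argo
  have Fx: "0 \<le> F x" using F(2) x by simp
  \<comment> \<open>By the centre identity \<open>U x \<le> F x + \<alpha> * W x\<close>, and
    \<open>\<alpha> * W x\<close> is at most \<open>F z0 / 8\<close>, hence at most 3/8 times
    \<open>F x\<close>.\<close>
  have Ux: "U x \<le> 2 * F x" using center W_small harnack F0 Fx by argo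
  show "(LINT z:{c1<..c2}|m. u z) \<le> 8 / h * F x"
    if c: "a0 \<le> c1" "c2 \<le> b0" and near: "\<And>z. z \<in> {c1<..c2} \<Longrightarrow> \<bar>s z - s x\<bar> \<le> h / 2" for c1 c2
  proof -
    \<comment> \<open>Within half the scale radius the kernel at the centre is at least
      \<open>h / 4\<close>; with \<open>U x \<le> 2 * F x\<close> this produces the constant
      \<open>8 / h\<close>.\<close>
    have "(LINT z:{c1<..c2}|m. h / 4 * u z) \<le> U x"
      unfolding U_def set_lebesgue_integral_def
    proof (rule integral_mono)
      show "integrable m (\<lambda>z. indicator {c1<..c2} z *\<^sub>R (h / 4 * u z))"
        using int[OF c continuous_on_mult_left[OF u(1)]] unfolding set_integrable_def .
      show "integrable m (\<lambda>z. indicator {a0<..b0} z *\<^sub>R (chord_kernel (s a0) (s b0) (s x) (s z) * u z))"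
        using int[OF order_refl order_refl cont_kernel[OF u(1)]] unfolding set_integrable_def .
      show "indicator {c1<..c2} z *\<^sub>R (h / 4 * u z)
          \<le> indicator {a0<..b0} z *\<^sub>R (chord_kernel (s a0) (s b0) (s x) (s z) * u z)" for z
      proof (cases "z \<in> {c1<..c2}")
        case True
        then have z: "z \<in> {a0<..b0}" using c by auto
        have "h / 4 \<le> chord_kernel (s a0) (s b0) (s x) (s z)" using near[OF True] by (simp add: kernel_mid)
        then have "h / 4 * u z \<le> chord_kernel (s a0) (s b0) (s x) (s z) * u z"
          using z u(2)[of z] by (intro mult_right_mono) auto
        then show ?thesis using True z by simp
      next
        case False
        then show ?thesis using u(2)[of z] kernel_nonneg[of a0 b0 x z] x by (auto simp: indicator_def)
      qed
    qed
    then have "h / 4 * (LINT z:{c1<..c2}|m. u z) \<le> 2 * F x" using Ux by simp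
    then show ?thesis using h by (simp add: field_simps)
  qed
  fix a b assume ab: "a0 \<le> a" "a < x" "x < b" "b \<le> b0"
  \<comment> \<open>The peak of the kernel of \<open>(a, b)\<close>. Its reciprocal is
    \<open>1 / (s b - s x) + 1 / (s x - s a)\<close>, so multiplication by \<kappa> turns the
    difference of quotients \<open>D\<close> into the chord excess, and bounding the kernel by its
    peak removes \<kappa> again.\<close>
  define \<kappa> where "\<kappa> = (s x - s a) * (s b - s x) / (s b - s a)"
  have pos: "0 < s x - s a" "0 < s b - s x" "0 < s b - s a"
    using ab s_less[of a x] s_less[of x b] by auto
  then have \<kappa>: "0 < \<kappa>" by (simp add: \<kappa>_def)
  have kernel_le: "chord_kernel (s a) (s b) (s x) (s z) \<le> \<kappa>" if "z \<in> {a<..b}" for z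
    unfolding \<kappa>_def using that ab by (intro chord_kernel_bounds s_less s_le) auto
  define D where "D = F b / (s b - s x) + F a / (s x - s a) - (1 / (s b - s x) + 1 / (s x - s a)) * F x"
  have "\<kappa> * D = (s b - s x) / (s b - s a) * F a + (s x - s a) / (s b - s a) * F b - F x"
  proof -
    have "\<kappa> / (s b - s x) = (s x - s a) / (s b - s a)" "\<kappa> / (s x - s a) = (s b - s x) / (s b - s a)"
      using pos by (auto simp: \<kappa>_def)
    moreover have "(s x - s a) / (s b - s a) + (s b - s x) / (s b - s a) = 1"
      using pos by (simp flip: add_divide_distrib)
    moreover have "\<kappa> * D = \<kappa> / (s b - s x) * F b + \<kappa> / (s x - s a) * F a - (\<kappa> / (s b - s x) + \<kappa> / (s x - s a)) * F x"
      by (simp add: D_def algebra_simps)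
    ultimately show ?thesis by simp
  qed
  also have "\<dots> = \<alpha> * (LINT z:{a<..b}|m. chord_kernel (s a) (s b) (s x) (s z) * F z)
      - (LINT z:{a<..b}|m. chord_kernel (s a) (s b) (s x) (s z) * u z)"
    using ab by (intro chord) auto
  finally have \<kappa>D: "\<kappa> * D = \<alpha> * (LINT z:{a<..b}|m. chord_kernel (s a) (s b) (s x) (s z) * F z)
      - (LINT z:{a<..b}|m. chord_kernel (s a) (s b) (s x) (s z) * u z)" .
  have nonneg: "0 \<le> (LINT z:{a<..b}|m. chord_kernel (s a) (s b) (s x) (s z) * k z)"
    if "\<And>z. z \<in> {a0..b0} \<Longrightarrow> 0 \<le> k z" for k
    unfolding set_lebesgue_integral_def using that ab kernel_nonneg[of a b x]
    by (intro integral_nonneg_AE AE_I2) (auto simp: indicator_def)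
  have "(LINT z:{a<..b}|m. chord_kernel (s a) (s b) (s x) (s z) * F z) \<le> (LINT z:{a<..b}|m. \<kappa> * (3 * F x))"
  proof (rule set_integral_mono)
    fix z assume z: "z \<in> {a<..b}"
    show "chord_kernel (s a) (s b) (s x) (s z) * F z \<le> \<kappa> * (3 * F x)"
      using z ab kernel_le[OF z] F(2)[of z] sup[of z] harnack kernel_nonneg[of a b x z] \<kappa> by (intro mult_mono) auto
  qed (use ab in \<open>auto intro!: int cont_kernel F continuous_intros\<close>)
  then have "\<alpha> * (LINT z:{a<..b}|m. chord_kernel (s a) (s b) (s x) (s z) * F z) \<le> \<alpha> * (\<kappa> * (3 * F x) * measure m {a<..b})"
    unfolding int_const using \<alpha>(1) by (intro mult_left_mono) auto
  then have "\<kappa> * D \<le> \<kappa> * (3 * \<alpha> * measure m {a<..b} * F x)"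
    using \<kappa>D nonneg[of u] u(2) by (simp add: mult_ac)
  then have "D \<le> 3 * \<alpha> * measure m {a<..b} * F x" using \<kappa> by simp
  then show "F b / (s b - s x) + F a / (s x - s a)
        \<le> (3 * \<alpha> * measure m {a<..b} + 1 / (s b - s x) + 1 / (s x - s a)) * F x"
    by (simp add: D_def algebra_simps)
  have "(LINT z:{a<..b}|m. chord_kernel (s a) (s b) (s x) (s z) * u z) \<le> (LINT z:{a<..b}|m. \<kappa> * u z)"
  proof (rule set_integral_mono)
    fix z assume z: "z \<in> {a<..b}"
    show "chord_kernel (s a) (s b) (s x) (s z) * u z \<le> \<kappa> * u z"
      using z ab kernel_le[OF z] u(2)[of z] by (intro mult_right_mono) auto
  qed (use ab in \<open>auto intro!: int cont_kernel u continuous_intros\<close>)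
  then have "(LINT z:{a<..b}|m. chord_kernel (s a) (s b) (s x) (s z) * u z) \<le> \<kappa> * (LINT z:{a<..b}|m. u z)"
    by simp
  moreover have "0 \<le> \<alpha> * (LINT z:{a<..b}|m. chord_kernel (s a) (s b) (s x) (s z) * F z)"
    using \<alpha>(1) F(2) by (intro mult_nonneg_nonneg nonneg) auto
  ultimately have "- (\<kappa> * D) \<le> \<kappa> * (LINT z:{a<..b}|m. u z)"
    using \<kappa>D by linarith
  then have "\<kappa> * (- D) \<le> \<kappa> * (LINT z:{a<..b}|m. u z)" by simp
  then have "- D \<le> (LINT z:{a<..b}|m. u z)" using \<kappa> by (simp only: mult_le_cancel_left_pos)
  then show "(1 / (s b - s x) + 1 / (s x - s a)) * F x
        \<le> F b / (s b - s x) + F a / (s x - s a) + (LINT z:{a<..b}|m. u z)"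
    by (simp add: D_def)
qed

section \<open>Smallness near an uncharged point and a Cauchy criterion\<close>

text \<open>This is where smooth fit depends on \<open>m\<close> not charging the point: the
  indicators of the shrinking intervals tend to 0 everywhere except at \<open>x\<close>, and
  dominated convergence applies with majorant \<open>\<bar>c y\<bar>\<close>.\<close>

lemma integral_punctured_nbhd_small:
  fixes c :: "real \<Rightarrow> real"
  assumes m: "sets m = sets borel" "emeasure m {x} = 0" and c: "integrable m c" and "0 < e"
  shows "\<exists>\<delta>>0. (LINT y|m. \<bar>c y\<bar> * indicator {x-\<delta><..<x+\<delta>} y) < e"
proof -
  define r where "r n = inverse (real (Suc n))" for n
  have r: "r \<longlonglongrightarrow> 0" "0 < r n" for n
    unfolding r_def by (rule LIMSEQ_inverse_real_of_nat) simp
  have [measurable]: "c \<in> borel_measurable m" using c by auto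
  have [measurable]: "{a<..<b} \<in> sets m" for a b :: real by (simp add: m)
  have "(\<lambda>n. LINT y|m. \<bar>c y\<bar> * indicator {x - r n<..<x + r n} y) \<longlonglongrightarrow> (LINT y|m. 0)"
  proof (rule integral_dominated_convergence[where w = "\<lambda>y. \<bar>c y\<bar>"])
    have "AE y in m. y \<noteq> x"
      by (rule AE_I[where N = "{x}"]) (use m in auto)
    then show "AE y in m. (\<lambda>n. \<bar>c y\<bar> * indicator {x - r n<..<x + r n} y) \<longlonglongrightarrow> 0"
    proof eventually_elim
      case (elim y)
      then have "\<forall>\<^sub>F n in sequentially. r n < \<bar>y - x\<bar>"
        using order_tendstoD(2)[OF r(1)] by simp
      then have "\<forall>\<^sub>F n in sequentially. \<bar>c y\<bar> * indicator {x - r n<..<x + r n} y = 0"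
        by eventually_elim (auto simp: indicator_def)
      then show ?case by (rule tendsto_eventually)
    qed
    show "AE y in m. norm (\<bar>c y\<bar> * indicator {x - r n<..<x + r n} y) \<le> \<bar>c y\<bar>" for n
      by (auto simp: indicator_def)
  qed (use c in auto)
  then have "\<forall>\<^sub>F n in sequentially. (LINT y|m. \<bar>c y\<bar> * indicator {x - r n<..<x + r n} y) < e"
    using order_tendstoD(2)[of _ 0 sequentially e] \<open>0 < e\<close> by simp
  then obtain n where "(LINT y|m. \<bar>c y\<bar> * indicator {x - r n<..<x + r n} y) < e"
    using eventually_happens'[OF sequentially_bot] by blast
  then show ?thesis using r(2) by blast
qed

text \<open>A chord compares only quotients on opposite sides of \<open>x\<close>. Two points on the
  same side are compared through a third one across \<open>x\<close>, at the cost of halving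
  \<open>e\<close>; completeness then gives the limit.\<close>

lemma tendsto_at_if_two_sided_Cauchy:
  fixes Q :: "real \<Rightarrow> real"
  assumes "\<And>e. 0 < e \<Longrightarrow> \<exists>\<delta>>0. \<forall>a b. x - \<delta> < a \<longrightarrow> a < x \<longrightarrow> x < b \<longrightarrow> b < x + \<delta> \<longrightarrow> \<bar>Q b - Q a\<bar> < e"
  shows "\<exists>d. (Q \<longlongrightarrow> d) (at x)"
proof -
  have close: "\<exists>\<delta>>0. \<forall>y z. y \<noteq> x \<longrightarrow> z \<noteq> x \<longrightarrow> \<bar>y - x\<bar> < \<delta> \<longrightarrow> \<bar>z - x\<bar> < \<delta> \<longrightarrow> \<bar>Q y - Q z\<bar> < e"
    if "0 < e" for e
  proof -
    obtain \<delta> where \<delta>: "0 < \<delta>"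
      and Q: "\<And>a b. x - \<delta> < a \<Longrightarrow> a < x \<Longrightarrow> x < b \<Longrightarrow> b < x + \<delta> \<Longrightarrow> \<bar>Q b - Q a\<bar> < e / 2"
      using assms[OF half_gt_zero[OF \<open>0 < e\<close>]] by blast
    have opp: "\<bar>Q y - Q z\<bar> < e / 2"
      if "\<bar>y - x\<bar> < \<delta>" "\<bar>z - x\<bar> < \<delta>" "y < x \<and> x < z \<or> z < x \<and> x < y" for y z
      using Q[of y z] Q[of z y] that by (auto simp: abs_minus_commute)
    have "\<bar>Q y - Q z\<bar> < e" if y: "y \<noteq> x" "\<bar>y - x\<bar> < \<delta>" and z: "z \<noteq> x" "\<bar>z - x\<bar> < \<delta>" for y z
    proof -
      define w where "w = (if y < x then x + \<delta> / 2 else x - \<delta> / 2)"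
      have w: "\<bar>w - x\<bar> < \<delta>" "y < x \<and> x < w \<or> w < x \<and> x < y"
        using \<delta> y by (auto simp: w_def)
      show ?thesis
      proof (cases "y < x \<longleftrightarrow> z < x")
        case True
        then have "\<bar>Q y - Q w\<bar> < e / 2" "\<bar>Q z - Q w\<bar> < e / 2"
          using opp[of y w] opp[of z w] y z w by auto
        then show ?thesis by argo
      next
        case False
        then have "\<bar>Q y - Q z\<bar> < e / 2" using opp[of y z] y z by auto
        then show ?thesis using \<open>0 < e\<close> by simp
      qed
    qed
    then show ?thesis using \<delta> by blast
  qed
  define r where "r n = x + inverse (real (Suc n))" for n
  have r: "r \<longlonglongrightarrow> x" "r n \<noteq> x" for n
    unfolding r_def by (rule LIMSEQ_inverse_real_of_nat_add) simp
  have "Cauchy (\<lambda>n. Q (r n))"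
  proof (rule metric_CauchyI)
    fix e :: real assume "0 < e"
    from close[OF this] obtain \<delta> where \<delta>: "0 < \<delta>"
      "\<And>y z. y \<noteq> x \<Longrightarrow> z \<noteq> x \<Longrightarrow> \<bar>y - x\<bar> < \<delta> \<Longrightarrow> \<bar>z - x\<bar> < \<delta> \<Longrightarrow> \<bar>Q y - Q z\<bar> < e" by blast
    obtain N where "\<And>n. n \<ge> N \<Longrightarrow> \<bar>r n - x\<bar> < \<delta>"
      using metric_LIMSEQ_D[OF r(1) \<delta>(1)] by (auto simp: dist_real_def)
    then show "\<exists>M. \<forall>m\<ge>M. \<forall>n\<ge>M. dist (Q (r m)) (Q (r n)) < e"
      using \<delta>(2) r(2) unfolding dist_real_def by (intro exI[of _ N]) blast
  qed
  then obtain d where d: "(\<lambda>n. Q (r n)) \<longlonglongrightarrow> d" using Cauchy_convergent_iff convergent_def by blast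
  have "(Q \<longlongrightarrow> d) (at x)"
  proof (rule metric_LIM_I)
    fix e :: real assume "0 < e"
    then obtain \<delta> where \<delta>: "0 < \<delta>"
      "\<And>y z. y \<noteq> x \<Longrightarrow> z \<noteq> x \<Longrightarrow> \<bar>y - x\<bar> < \<delta> \<Longrightarrow> \<bar>z - x\<bar> < \<delta> \<Longrightarrow> \<bar>Q y - Q z\<bar> < e / 2"
      using close[OF half_gt_zero] by blast
    have "\<forall>\<^sub>F n in sequentially. \<bar>r n - x\<bar> < \<delta> \<and> \<bar>Q (r n) - d\<bar> < e / 2"
      using tendstoD[OF r(1) \<delta>(1)] tendstoD[OF d, of "e / 2"] \<open>0 < e\<close>
      by (simp add: dist_real_def eventually_conj)
    then obtain n where n: "\<bar>r n - x\<bar> < \<delta>" "\<bar>Q (r n) - d\<bar> < e / 2"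
      using eventually_happens'[OF sequentially_bot] by blast
    have "dist (Q y) d < e" if "y \<noteq> x" "dist y x < \<delta>" for y
    proof -
      have "\<bar>Q y - Q (r n)\<bar> < e / 2"
        using that n(1) r(2) by (intro \<delta>(2)) (auto simp: dist_real_def)
      then show ?thesis using n(2) unfolding dist_real_def by argo
    qed
    then show "\<exists>\<delta>>0. \<forall>y. y \<noteq> x \<and> dist y x < \<delta> \<longrightarrow> dist (Q y) d < e"
      using \<delta>(1) by blast
  qed
  then show ?thesis by blast
qed

section \<open>Almost everywhere estimates for the resolvent densities\<close>

text \<open>Each chord estimate for the resolvent of \<open>u\<close> is an inequality between
  integrals of \<open>u\<close> against fixed nonnegative densities. Since \<open>u\<close> ranges
  over all continuous functions with values between 0 and 1, it passes to the densities.\<close>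

lemma (in diffusion) resolvent_kernel_estimates:
  assumes s: "scale_function I \<Omega> X P s" and sm: "speed_measure I X P s m"
    and td: "transition_density I \<Omega> X P m p" and \<alpha>: "0 < \<alpha>" and x: "x \<in> interior I"
  obtains a0 b0 h where "a0 < x" "x < b0" "{a0..b0} \<subseteq> interior I" "0 < h"
    "AE y in m. indicator {a0<..b0} y \<le> h * resolvent_kernel I p \<alpha> x y"
    "\<And>a b. a0 \<le> a \<Longrightarrow> a < x \<Longrightarrow> x < b \<Longrightarrow> b \<le> b0 \<Longrightarrow> AE y in m.
      \<bar>resolvent_kernel I p \<alpha> b y / (s b - s x) + resolvent_kernel I p \<alpha> a y / (s x - s a)
        - (1 / (s b - s x) + 1 / (s x - s a)) * resolvent_kernel I p \<alpha> x y\<bar>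
      \<le> 3 * \<alpha> * measure m {a<..b} * resolvent_kernel I p \<alpha> x y + indicator {a<..b} y"
proof -
  let ?K = "resolvent_kernel I p \<alpha>"
  have int_I: "interior I \<subseteq> I" by (rule interior_subset)
  have m: "sets m = sets borel" "emeasure m (- I) = 0"
    and fin: "\<And>a b. a \<in> I \<Longrightarrow> b \<in> I \<Longrightarrow> emeasure m {a..b} < \<top>"
    and Feller: "\<And>u. continuous_on I u \<Longrightarrow> bounded (u ` I) \<Longrightarrow>
      Feller_domain I s m (resolvent X P \<alpha> u) (\<lambda>x. \<alpha> * resolvent X P \<alpha> u x - u x)"
    using sm \<alpha> by (auto simp: speed_measure_def)
  have sf: "sigma_finite_measure m"
    by (rule sigma_finite_if_finite_on_Icc) (use m fin in auto)
  note R = resolvent_eq_integral_kernel[OF td m(1) sf _ \<alpha>]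
  have K_nonneg: "0 \<le> ?K y z" if "y \<in> I" for y z
    by (rule resolvent_kernel_nonneg[OF td that])
  obtain e where "0 < e" and e: "cball x e \<subseteq> interior I"
    using x open_contains_cball[of "interior I"] by auto
  define a1 b1 where "a1 = x - e" "b1 = x + e"
  have ab1: "a1 < x" "x < b1" "{a1..b1} \<subseteq> interior I"
    using \<open>0 < e\<close> e by (auto simp: a1_b1_def cball_eq_atLeastAtMost)
  have cs: "continuous_on {a1..b1} s" and ms: "strict_mono_on {a1..b1} s"
    using s ab1 int_I by (auto simp: scale_function_def intro: continuous_on_subset monotone_on_subset)
  have s_less: "s y < s z" if "a1 \<le> y" "y < z" "z \<le> b1" for y z
    using that by (intro strict_mono_onD[OF ms]) auto
  define M where "M = measure m {a1..b1}"
  have "0 \<le> M" by (simp add: M_def)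
  \<comment> \<open>The first two terms keep \<open>s x - h\<close> and \<open>s x + h\<close> in
    the range of \<open>s\<close>; the third gives
    \<open>\<alpha> * (2 * h) * M \<le> 1 / 8\<close>. The mass \<open>M\<close> belongs to the
    larger interval, fixed before \<open>h\<close>, because \<open>a0\<close> and \<open>b0\<close>
    depend on \<open>h\<close>; \<open>M + 1\<close> keeps the denominator positive.\<close>
  define h where "h = min (min (s x - s a1) (s b1 - s x)) (1 / (16 * \<alpha> * (M + 1)))"
  have h: "0 < h" "s a1 \<le> s x - h" "s x + h \<le> s b1" "h \<le> 1 / (16 * \<alpha> * (M + 1))"
    using ab1 s_less[of a1 x] s_less[of x b1] \<alpha> \<open>0 \<le> M\<close> by (auto simp: h_def)
  have hM: "\<alpha> * (2 * h) * M \<le> 1 / 8"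
  proof -
    have "h * (16 * \<alpha> * (M + 1)) \<le> 1" using h(4) \<alpha> \<open>0 \<le> M\<close> by (simp add: le_divide_eq)
    moreover have "\<alpha> * h \<ge> 0" using \<alpha> h by simp
    ultimately show ?thesis by (simp add: algebra_simps)
  qed
  have left: "\<exists>a. a1 \<le> a \<and> a < x \<and> s a = s x - t" if "0 < t" "t \<le> h" for t
  proof -
    have "\<exists>a\<ge>a1. a \<le> x \<and> s a = s x - t"
      using that h ab1 by (intro IVT' continuous_on_subset[OF cs]) auto
    then show ?thesis using that by (force simp: order_le_less)
  qed
  have right: "\<exists>b. x < b \<and> b \<le> b1 \<and> s b = s x + t" if "0 < t" "t \<le> h" for t
  proof -
    have "\<exists>b\<ge>x. b \<le> b1 \<and> s b = s x + t"
      using that h ab1 by (intro IVT' continuous_on_subset[OF cs]) auto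
    then show ?thesis using that by (force simp: order_le_less)
  qed
  obtain a0 where a0: "a1 \<le> a0" "a0 < x" "s a0 = s x - h" using left[of h] h by auto
  obtain b0 where b0: "x < b0" "b0 \<le> b1" "s b0 = s x + h" using right[of h] h by auto
  \<comment> \<open>Half the scale radius: the kernel at the centre degenerates to 0 at
    \<open>a0\<close> and \<open>b0\<close>, but stays at least \<open>h / 4\<close> between
    \<open>c1\<close> and \<open>c2\<close>.\<close>
  obtain c1 where c1: "a1 \<le> c1" "c1 < x" "s c1 = s x - h / 2" using left[of "h / 2"] h by auto
  obtain c2 where c2: "x < c2" "c2 \<le> b1" "s c2 = s x + h / 2" using right[of "h / 2"] h by auto
  have c01: "a0 \<le> c1" using s_less[of c1 a0] a0 c1 h ab1 by linarith
  have c02: "c2 \<le> b0" using s_less[of b0 c2] b0 c2 h ab1 by linarith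
  have sub01: "{a0..b0} \<subseteq> {a1..b1}" using a0 b0 by auto
  have near: "\<bar>s z - s x\<bar> \<le> h / 2" if "z \<in> {c1<..c2}" for z
  proof -
    have "s c1 \<le> s z" "s z \<le> s c2"
      using that c1 c2 s_less[of c1 z] s_less[of z c2] by (cases "z = c2"; auto)+
    then show ?thesis using c1 c2 by (auto simp: abs_if)
  qed
  have I1: "{a1..b1} \<subseteq> I" using ab1(3) int_I by blast
  have fin0: "emeasure m {a0..b0} < \<top>" 
    by (intro fin subsetD[OF I1]) (use a0 b0 in auto)
  have M0: "measure m {a0..b0} \<le> M"
  proof -
    have "emeasure m {a1..b1} < \<top>"
      by (intro fin subsetD[OF I1]) (use ab1 in auto)
    then show ?thesis unfolding M_def using sub01 m by (intro measure_mono_fmeasurable) (auto simp: fmeasurable_def)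
  qed
  have hM0: "\<alpha> * (2 * h) * measure m {a0..b0} \<le> 1 / 8"
    by (rule order.trans[OF mult_left_mono[OF M0] hM]) (use \<alpha> h in simp)
  have cs0: "continuous_on {a0..b0} s" and ms0: "strict_mono_on {a0..b0} s"
    using sub01 cs ms by (auto intro: continuous_on_subset monotone_on_subset)
  have sub0: "{a0..b0} \<subseteq> interior I" using sub01 ab1 by blast
  have int_u: "set_integrable m {a<..b} u" if "a0 \<le> a" "b \<le> b0" "continuous_on UNIV u" for a b and u :: "real \<Rightarrow> real"
    by (rule set_integrable_subset[OF set_integrable_Ioc_if_continuous[OF m(1) fin0]])
      (use m that in \<open>auto intro: continuous_on_subset\<close>)
  have int_ind: "integrable m (indicator {a<..b} :: real \<Rightarrow> real)" if "a0 \<le> a" "b \<le> b0" for a b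
    using int_u[OF that, of "\<lambda>_. 1"] by (simp add: set_integrable_def)
  have test: "(LINT z:{c1<..c2}|m. u z) \<le> 8 / h * (LINT y|m. ?K x y * u y) \<and>
     (\<forall>a b. a0 \<le> a \<longrightarrow> a < x \<longrightarrow> x < b \<longrightarrow> b \<le> b0 \<longrightarrow>
      (LINT y|m. ?K b y * u y) / (s b - s x) + (LINT y|m. ?K a y * u y) / (s x - s a)
        \<le> (3 * \<alpha> * measure m {a<..b} + 1 / (s b - s x) + 1 / (s x - s a)) * (LINT y|m. ?K x y * u y) \<and>
      (1 / (s b - s x) + 1 / (s x - s a)) * (LINT y|m. ?K x y * u y)
        \<le> (LINT y|m. ?K b y * u y) / (s b - s x) + (LINT y|m. ?K a y * u y) / (s x - s a) + (LINT z:{a<..b}|m. u z))"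
    if u: "continuous_on UNIV u" "\<And>y. 0 \<le> u y" "\<And>y. u y \<le> 1" for u
  proof -
    define F where "F = resolvent X P \<alpha> u"
    have F_eq: "F y = (LINT z|m. ?K y z * u z)" if "y \<in> I" for y
      unfolding F_def using R(2)[OF that u(1)] u(2,3) by (simp add: abs_le_iff order.trans[OF _ u(2)])
    have F_nonneg: "0 \<le> F y" if "y \<in> I" for y
      unfolding F_eq[OF that] using K_nonneg[OF that] u(2) by (intro integral_nonneg_AE AE_I2) auto
    have "bounded (u ` I)"
      using u(2,3) by (auto simp: bounded_iff intro!: exI[of _ 1])
    then have FD: "Feller_domain I s m F (\<lambda>y. \<alpha> * F y - u y)"
      unfolding F_def using u(1) by (intro Feller) (auto intro: continuous_on_subset)
    have F_cont: "continuous_on {a0..b0} F"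
      using FD sub0 int_I by (auto simp: Feller_domain_def intro: continuous_on_subset)
    have u_cont: "continuous_on {a0..b0} u" using u(1) by (rule continuous_on_subset) simp
    have deriv: "has_right_scale_deriv s F (right_scale_deriv s F t) t" if "t \<in> {a0..b0}" for t
    proof -
      have "t \<in> interior I" using that sub0 by blast
      then obtain d where "has_right_scale_deriv s F d t" using FD unfolding Feller_domain_def by blast
      then show ?thesis
        by (auto simp: has_right_scale_deriv_def right_scale_deriv_def dest: tendsto_Lim[OF trivial_limit_at_right_real])
    qed
    have incr: "right_scale_deriv s F z - right_scale_deriv s F y = (LINT t:{y<..z}|m. \<alpha> * F t - u t)"
      if "a0 \<le> y" "y < z" "z \<le> b0" for y z
    proof -
      have "y \<in> interior I" "z \<in> interior I" using that sub0 by auto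
      then show ?thesis using FD \<open>y < z\<close> by (simp add: Feller_domain_def)
    qed
    have xI: "x \<in> I" using x int_I by auto
    have F0: "0 \<le> F z" if "z \<in> {a0..b0}" for z using F_nonneg that sub0 int_I by blast
    note est = chord_estimates[OF m(1) fin0 a0(2) b0(1) a0(3) b0(3) cs0 ms0 F_cont F0 u_cont u(2) deriv incr \<alpha> hM0]
    have "(LINT z:{c1<..c2}|m. u z) \<le> 8 / h * F x"
      by (rule est(1)) (assumption | rule c01 c02 near)+
    moreover have "F b / (s b - s x) + F a / (s x - s a)
        \<le> (3 * \<alpha> * measure m {a<..b} + 1 / (s b - s x) + 1 / (s x - s a)) * F x"
      if "a0 \<le> a" "a < x" "x < b" "b \<le> b0" for a b
      by (rule est(2)) (assumption | rule that)+
    moreover have "(1 / (s b - s x) + 1 / (s x - s a)) * F x \<le> F b / (s b - s x) + F a / (s x - s a) + (LINT z:{a<..b}|m. u z)"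
      if "a0 \<le> a" "a < x" "x < b" "b \<le> b0" for a b
      by (rule est(3)) (assumption | rule that)+
    moreover have "a \<in> I" if "a0 \<le> a" "a \<le> b0" for a using that sub0 int_I by auto
    ultimately show ?thesis using F_eq xI by simp
  qed
  have xI: "x \<in> I" using x int_I by auto
  have near_pos: "AE y in m. indicator {c1<..c2} y \<le> 8 / h * ?K x y"
  proof (rule AE_le_if_integral_continuous_le[OF m(1)])
    show "integrable m (indicator {c1<..c2} :: real \<Rightarrow> real)" by (rule int_ind[OF c01 c02])
    show "integrable m (\<lambda>y. 8 / h * ?K x y)" using R(1)[OF xI] by simp
    show "0 \<le> 8 / h * ?K x y" for y using K_nonneg[OF xI] h by simp
    fix u :: "real \<Rightarrow> real" assume "continuous_on UNIV u" "\<And>y. 0 \<le> u y" "\<And>y. u y \<le> 1"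
    from test[OF this] show "(LINT y|m. indicator {c1<..c2} y * u y) \<le> (LINT y|m. 8 / h * ?K x y * u y)"
      by (simp add: set_lebesgue_integral_def mult.assoc)
  qed simp
  have chord_AE: "AE y in m. \<bar>?K b y / (s b - s x) + ?K a y / (s x - s a) - (1 / (s b - s x) + 1 / (s x - s a)) * ?K x y\<bar>
      \<le> 3 * \<alpha> * measure m {a<..b} * ?K x y + indicator {a<..b} y"
    if ab: "c1 \<le> a" "a < x" "x < b" "b \<le> c2" for a b
  proof -
    have ab0: "a0 \<le> a" "b \<le> b0" using ab c01 c02 by auto
    have "{a, b} \<subseteq> {a1..b1}" using ab c1 c2 by auto
    then have abI: "a \<in> I" "b \<in> I" using I1 by auto
    have pos: "0 < s b - s x" "0 < s x - s a" using ab c1 c2 s_less[of x b] s_less[of a x] by auto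
    have Ku: "integrable m (\<lambda>z. ?K y z * u z)"
      if "y \<in> I" "continuous_on UNIV u" "\<And>z. 0 \<le> u z" "\<And>z. u z \<le> 1" for y and u :: "real \<Rightarrow> real"
    proof (rule Bochner_Integration.integrable_bound[OF R(1)[OF that(1)]])
      have "u \<in> borel_measurable m"
        using borel_measurable_continuous_onI[OF that(2)] by (simp cong: measurable_cong_sets add: m)
      then show "(\<lambda>z. ?K y z * u z) \<in> borel_measurable m" using R(1)[OF that(1)] by auto
      show "AE z in m. norm (?K y z * u z) \<le> norm (?K y z)"
        using that(3,4) by (intro AE_I2) (simp add: abs_mult mult_left_le)
    qed
    have upper: "AE y in m. ?K b y / (s b - s x) + ?K a y / (s x - s a)
        \<le> (3 * \<alpha> * measure m {a<..b} + 1 / (s b - s x) + 1 / (s x - s a)) * ?K x y"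
    proof (rule AE_le_if_integral_continuous_le[OF m(1)])
      show "integrable m (\<lambda>y. ?K b y / (s b - s x) + ?K a y / (s x - s a))"
        "integrable m (\<lambda>y. (3 * \<alpha> * measure m {a<..b} + 1 / (s b - s x) + 1 / (s x - s a)) * ?K x y)"
        using R(1)[OF xI] R(1)[OF abI(1)] R(1)[OF abI(2)] by auto
      show "0 \<le> ?K b y / (s b - s x) + ?K a y / (s x - s a)"
        "0 \<le> (3 * \<alpha> * measure m {a<..b} + 1 / (s b - s x) + 1 / (s x - s a)) * ?K x y" for y
        using K_nonneg[OF xI] K_nonneg[OF abI(1)] K_nonneg[OF abI(2)] pos \<alpha> by auto
      fix u :: "real \<Rightarrow> real" assume u: "continuous_on UNIV u" "\<And>y. 0 \<le> u y" "\<And>y. u y \<le> 1"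
      have "(LINT y|m. (?K b y / (s b - s x) + ?K a y / (s x - s a)) * u y)
          = (LINT y|m. ?K b y * u y) / (s b - s x) + (LINT y|m. ?K a y * u y) / (s x - s a)"
        using Ku[OF abI(1) u] Ku[OF abI(2) u] by (simp add: distrib_right)
      then show "(LINT y|m. (?K b y / (s b - s x) + ?K a y / (s x - s a)) * u y)
          \<le> (LINT y|m. (3 * \<alpha> * measure m {a<..b} + 1 / (s b - s x) + 1 / (s x - s a)) * ?K x y * u y)"
        using test[OF u] ab ab0 by (simp add: mult.assoc)
    qed
    have lower: "AE y in m. (1 / (s b - s x) + 1 / (s x - s a)) * ?K x y
        \<le> ?K b y / (s b - s x) + ?K a y / (s x - s a) + indicator {a<..b} y"
    proof (rule AE_le_if_integral_continuous_le[OF m(1)])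
      show "integrable m (\<lambda>y. ?K b y / (s b - s x) + ?K a y / (s x - s a) + indicator {a<..b} y)"
        "integrable m (\<lambda>y. (1 / (s b - s x) + 1 / (s x - s a)) * ?K x y)"
        using R(1)[OF xI] R(1)[OF abI(1)] R(1)[OF abI(2)] int_ind[OF ab0] by auto
      show "0 \<le> ?K b y / (s b - s x) + ?K a y / (s x - s a) + indicator {a<..b} y"
        "0 \<le> (1 / (s b - s x) + 1 / (s x - s a)) * ?K x y" for y
        using K_nonneg[OF xI] K_nonneg[OF abI(1)] K_nonneg[OF abI(2)] pos by auto
      fix u :: "real \<Rightarrow> real" assume u: "continuous_on UNIV u" "\<And>y. 0 \<le> u y" "\<And>y. u y \<le> 1"
      have "(LINT y|m. (?K b y / (s b - s x) + ?K a y / (s x - s a) + indicator {a<..b} y) * u y)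
          = (LINT y|m. ?K b y * u y) / (s b - s x) + (LINT y|m. ?K a y * u y) / (s x - s a) + (LINT z:{a<..b}|m. u z)"
        using Ku[OF abI(1) u] Ku[OF abI(2) u] int_u[OF ab0 u(1)]
        by (simp add: distrib_right set_lebesgue_integral_def set_integrable_def)
      then show "(LINT y|m. (1 / (s b - s x) + 1 / (s x - s a)) * ?K x y * u y)
          \<le> (LINT y|m. (?K b y / (s b - s x) + ?K a y / (s x - s a) + indicator {a<..b} y) * u y)"
        using test[OF u] ab ab0 by (simp add: mult.assoc)
    qed
    from upper lower show ?thesis
    proof eventually_elim
      case (elim y)
      have "0 \<le> 3 * \<alpha> * measure m {a<..b} * ?K x y" using K_nonneg[OF xI] \<alpha> by simp
      moreover have "0 \<le> (indicator {a<..b} y :: real)" by simp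
      moreover have "(3 * \<alpha> * measure m {a<..b} + 1 / (s b - s x) + 1 / (s x - s a)) * ?K x y
          = 3 * \<alpha> * measure m {a<..b} * ?K x y + (1 / (s b - s x) + 1 / (s x - s a)) * ?K x y"
        by (simp only: distrib_right add.assoc)
      ultimately show ?case using elim unfolding abs_le_iff by linarith
    qed
  qed
  \<comment> \<open>The interval handed out is the inner one, from \<open>c1\<close> to
    \<open>c2\<close>, where the lower bound on the kernel holds; the constant called
    \<open>h\<close> in the conclusion is \<open>8 / h\<close> here.\<close>
  show ?thesis
  proof (rule that[OF c1(2) c2(1) _ _ near_pos chord_AE])
    show "{c1..c2} \<subseteq> interior I" using order.trans[OF _ sub0, of "{c1..c2}"] c01 c02 by simp
    show "0 < 8 / h" using h by simp
  qed
qed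

section \<open>Smooth fit from the kernel estimates\<close>

theorem mainTheorem5:
  fixes I :: "real set" and \<Omega> :: "'w set"
    and X :: "real \<Rightarrow> 'w \<Rightarrow> real" and P :: "real \<Rightarrow> 'w measure"
    and s :: "real \<Rightarrow> real" and m :: "real measure" and p :: "real \<Rightarrow> real \<Rightarrow> real \<Rightarrow> real"
    and \<alpha> :: real and g :: "real \<Rightarrow> real" and xs :: real
  assumes "diffusion I \<Omega> X P"
    and "scale_function I \<Omega> X P s"
    and "speed_measure I X P s m"
    and "transition_density I \<Omega> X P m p"
    and "\<alpha> > 0"
    and "\<And>x. x \<in> I \<Longrightarrow> 0 \<le> g x"
    and "lower_semicontinuous_on I g"
    and "xs \<in> interior I"
    and "AE y in m. y \<in> I \<inter> {xs<..} \<longrightarrow> (\<exists>d. has_generator I s m g y d)"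
    and "\<And>x. x \<in> I \<Longrightarrow> set_integrable m (I \<inter> {xs<..})
               (\<lambda>y. Green_function p \<alpha> x y * (\<alpha> * g y - generator I s m g y))"
    and "\<And>x. x \<in> I \<Longrightarrow> value_function I \<Omega> X P \<alpha> g x < \<top>"
    and "\<And>x. x \<in> I \<Longrightarrow> enn2real (value_function I \<Omega> X P \<alpha> g x) =
               (LINT y:I \<inter> {xs<..}|m. Green_function p \<alpha> x y * (\<alpha> * g y - generator I s m g y))"
    and "emeasure m {xs} = 0"
  shows "\<exists>d. ((\<lambda>x. (enn2real (value_function I \<Omega> X P \<alpha> g x) - enn2real (value_function I \<Omega> X P \<alpha> g xs))
               / (s x - s xs)) \<longlongrightarrow> d) (at xs)"
proof -
  interpret diffusion I \<Omega> X P by fact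
  let ?K = "resolvent_kernel I p \<alpha>"
  \<comment> \<open>The restriction to \<open>I\<close> is carried by the kernel and the restriction
    to points above \<open>xs\<close> by \<open>f\<close>, so the value function becomes an integral
    over the whole line.\<close>
  define f where "f y = indicator {xs<..} y * (\<alpha> * g y - generator I s m g y)" for y
  define V where "V x = enn2real (value_function I \<Omega> X P \<alpha> g x)" for x
  have m: "sets m = sets borel" using assms(3) by (simp add: speed_measure_def)
  have Kf: "indicator (I \<inter> {xs<..}) y *\<^sub>R (Green_function p \<alpha> x y * (\<alpha> * g y - generator I s m g y)) = ?K x y * f y" for x y
    by (simp add: resolvent_kernel_def f_def indicator_inter_arith)
  have int: "integrable m (\<lambda>y. ?K x y * f y)" if "x \<in> I" for x
    using assms(10)[OF that] unfolding set_integrable_def Kf .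
  have V: "V x = (LINT y|m. ?K x y * f y)" if "x \<in> I" for x
    using assms(12)[OF that] unfolding V_def set_lebesgue_integral_def Kf .
  obtain a0 b0 h where ab0: "a0 < xs" "xs < b0" "{a0..b0} \<subseteq> interior I" and "0 < h"
    and near: "AE y in m. indicator {a0<..b0} y \<le> h * ?K xs y"
    and chord: "\<And>a b. a0 \<le> a \<Longrightarrow> a < xs \<Longrightarrow> xs < b \<Longrightarrow> b \<le> b0 \<Longrightarrow> AE y in m.
      \<bar>?K b y / (s b - s xs) + ?K a y / (s xs - s a) - (1 / (s b - s xs) + 1 / (s xs - s a)) * ?K xs y\<bar>
      \<le> 3 * \<alpha> * measure m {a<..b} * ?K xs y + indicator {a<..b} y"
    by (rule resolvent_kernel_estimates[OF assms(2,3,4,5,8)]) (rule that; blast)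
  have I: "{a0..b0} \<subseteq> I" using ab0(3) interior_subset by blast
  have xsI: "xs \<in> I" using I ab0 by auto
  have K_nonneg: "0 \<le> ?K xs y" for y by (rule resolvent_kernel_nonneg[OF assms(4) xsI])
  have fin0: "emeasure m {a0..b0} < \<top>" 
  proof -
    have "a0 \<in> I" "b0 \<in> I" using I ab0 by auto
    then show ?thesis using assms(3) unfolding speed_measure_def by blast
  qed
  have fin: "integrable m (indicator {a0<..b0} :: real \<Rightarrow> real)"
    using set_integrable_Ioc_if_continuous[OF m fin0 continuous_on_const[of _ 1]] by (simp add: set_integrable_def)
  define J where "J = (LINT y|m. \<bar>?K xs y * f y\<bar>)"
  have "0 \<le> J" by (simp add: J_def)
  \<comment> \<open>One integrable majorant, independent of \<open>a\<close> and \<open>b\<close>.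
    Its first term rewrites the Harnack error \<open>3 * \<alpha> * measure m {a<..b} * J\<close> as
    an integral over \<open>{a<..b}\<close>; its second term replaces
    \<open>\<bar>f y\<bar>\<close>, which need not be integrable against \<open>m\<close>, by
    \<open>h * \<bar>?K xs y * f y\<bar>\<close>.\<close>
  define c where "c y = 3 * \<alpha> * J * indicator {a0<..b0} y + h * \<bar>?K xs y * f y\<bar>" for y
  have c_int: "integrable m c"
    unfolding c_def using int[OF xsI] fin by auto
  have c_nonneg: "0 \<le> c y" for y
    using \<open>0 \<le> J\<close> \<open>0 < h\<close> assms(5) by (auto simp: c_def)
  define Q where "Q x = (V x - V xs) / (s x - s xs)" for x
  have Q_diff: "\<bar>Q b - Q a\<bar> \<le> (LINT y|m. \<bar>c y\<bar> * indicator {a<..b} y)"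
    if ab: "a0 < a" "a < xs" "xs < b" "b < b0" for a b
  proof -
    have abI: "a \<in> I" "b \<in> I" using ab I by auto
    have [measurable]: "{a<..b} \<in> sets m" by (simp add: m)
    have "set_integrable m {a<..b} (\<lambda>_. 1 :: real)"
      by (rule set_integrable_subset[OF set_integrable_Ioc_if_continuous[OF m fin0 continuous_on_const]]) (use ab m in auto)
    moreover have "set_integrable m {a<..b} (\<lambda>y. h * \<bar>?K xs y * f y\<bar>)"
      unfolding set_integrable_def using int[OF xsI] by (intro integrable_mult_indicator) auto
    ultimately have ind: "integrable m (indicator {a<..b} :: real \<Rightarrow> real)"
      "integrable m (\<lambda>y. h * \<bar>?K xs y * f y\<bar> * indicator {a<..b} y)"
      by (simp_all add: set_integrable_def mult.commute)
    have "Q b - Q a = V b / (s b - s xs) + V a / (s xs - s a) - (1 / (s b - s xs) + 1 / (s xs - s a)) * V xs"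
    proof -
      have "(V a - V xs) / (s a - s xs) = (V xs - V a) / (s xs - s a)"
        by (metis minus_diff_eq minus_divide_divide)
      then show ?thesis by (simp add: Q_def diff_divide_distrib distrib_right)
    qed
    also have "\<dots> = (LINT y|m. (?K b y / (s b - s xs) + ?K a y / (s xs - s a) - (1 / (s b - s xs) + 1 / (s xs - s a)) * ?K xs y) * f y)"
      using int[OF abI(1)] int[OF abI(2)] int[OF xsI]
      by (simp add: V abI xsI distrib_right left_diff_distrib mult.assoc)
    finally have Q_eq: "Q b - Q a = (LINT y|m. (?K b y / (s b - s xs) + ?K a y / (s xs - s a) - (1 / (s b - s xs) + 1 / (s xs - s a)) * ?K xs y) * f y)" .
    have "\<bar>Q b - Q a\<bar> \<le> (LINT y|m. 3 * \<alpha> * measure m {a<..b} * \<bar>?K xs y * f y\<bar> + h * \<bar>?K xs y * f y\<bar> * indicator {a<..b} y)"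
      unfolding Q_eq
    proof (rule order.trans[OF integral_abs_bound integral_mono_AE])
      show "integrable m (\<lambda>y. \<bar>(?K b y / (s b - s xs) + ?K a y / (s xs - s a) - (1 / (s b - s xs) + 1 / (s xs - s a)) * ?K xs y) * f y\<bar>)"
        using int[OF abI(1)] int[OF abI(2)] int[OF xsI]
        by (intro integrable_abs) (simp add: distrib_right left_diff_distrib mult.assoc)
      show "integrable m (\<lambda>y. 3 * \<alpha> * measure m {a<..b} * \<bar>?K xs y * f y\<bar> + h * \<bar>?K xs y * f y\<bar> * indicator {a<..b} y)"
        using int[OF xsI] ind by auto
      have "AE y in m. \<bar>?K b y / (s b - s xs) + ?K a y / (s xs - s a) - (1 / (s b - s xs) + 1 / (s xs - s a)) * ?K xs y\<bar>
          \<le> 3 * \<alpha> * measure m {a<..b} * ?K xs y + indicator {a<..b} y"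
        using ab by (intro chord) auto
      with near show "AE y in m. \<bar>(?K b y / (s b - s xs) + ?K a y / (s xs - s a) - (1 / (s b - s xs) + 1 / (s xs - s a)) * ?K xs y) * f y\<bar>
          \<le> 3 * \<alpha> * measure m {a<..b} * \<bar>?K xs y * f y\<bar> + h * \<bar>?K xs y * f y\<bar> * indicator {a<..b} y"
      proof eventually_elim
        case (elim y)
        \<comment> \<open>The lower bound on the kernel enters here: the summand without a kernel
          factor acquires the factor \<open>?K xs y\<close> before it is multiplied by
          \<open>\<bar>f y\<bar>\<close>.\<close>
        have "indicator {a<..b} y \<le> h * ?K xs y * indicator {a<..b} y"
          using elim(1) ab by (auto simp: indicator_def)
        then have "3 * \<alpha> * measure m {a<..b} * ?K xs y + indicator {a<..b} y
            \<le> 3 * \<alpha> * measure m {a<..b} * ?K xs y + h * ?K xs y * indicator {a<..b} y" by simp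
        from mult_right_mono[OF order.trans[OF elim(2) this] abs_ge_zero[of "f y"]]
        have "\<bar>(?K b y / (s b - s xs) + ?K a y / (s xs - s a) - (1 / (s b - s xs) + 1 / (s xs - s a)) * ?K xs y) * f y\<bar>
            \<le> (3 * \<alpha> * measure m {a<..b} * ?K xs y + h * ?K xs y * indicator {a<..b} y) * \<bar>f y\<bar>"
          by (simp only: abs_mult)
        also have "\<dots> = 3 * \<alpha> * measure m {a<..b} * \<bar>?K xs y * f y\<bar> + h * \<bar>?K xs y * f y\<bar> * indicator {a<..b} y"
          using K_nonneg[of y] by (simp add: abs_mult algebra_simps)
        finally show ?case .
      qed
    qed
    also have "\<dots> = 3 * \<alpha> * measure m {a<..b} * J + (LINT y|m. h * \<bar>?K xs y * f y\<bar> * indicator {a<..b} y)"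
      by (subst Bochner_Integration.integral_add[OF integrable_mult_right[OF integrable_abs[OF int[OF xsI]]] ind(2)])
        (simp only: integral_mult_right_zero J_def)
    also have "\<dots> = (LINT y|m. 3 * \<alpha> * J * indicator {a<..b} y + h * \<bar>?K xs y * f y\<bar> * indicator {a<..b} y)"
    proof -
      have "(LINT y|m. indicator {a<..b} y) = measure m {a<..b}"
        using sets_eq_imp_space_eq[OF m] by simp
      then show ?thesis
        by (subst Bochner_Integration.integral_add[OF integrable_mult_right[OF ind(1)] ind(2)])
          (simp only: integral_mult_right_zero mult_ac)
    qed
    also have "\<dots> = (LINT y|m. \<bar>c y\<bar> * indicator {a<..b} y)"
      using ab c_nonneg by (intro Bochner_Integration.integral_cong) (auto simp: c_def indicator_def)
    finally show ?thesis .
  qed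
  have "\<exists>\<delta>>0. \<forall>a b. xs - \<delta> < a \<longrightarrow> a < xs \<longrightarrow> xs < b \<longrightarrow> b < xs + \<delta> \<longrightarrow> \<bar>Q b - Q a\<bar> < e" if "0 < e" for e
  proof -
    obtain \<delta> where \<delta>: "0 < \<delta>" "(LINT y|m. \<bar>c y\<bar> * indicator {xs-\<delta><..<xs+\<delta>} y) < e"
      using integral_punctured_nbhd_small[OF m assms(13) c_int \<open>0 < e\<close>] by blast
    have "\<bar>Q b - Q a\<bar> < e" if "xs - min \<delta> (min (xs - a0) (b0 - xs)) < a" "a < xs" "xs < b"
      "b < xs + min \<delta> (min (xs - a0) (b0 - xs))" for a b
    proof -
      have "\<bar>Q b - Q a\<bar> \<le> (LINT y|m. \<bar>c y\<bar> * indicator {a<..b} y)"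
        using that by (intro Q_diff) auto
      also have "\<dots> \<le> (LINT y|m. \<bar>c y\<bar> * indicator {xs-\<delta><..<xs+\<delta>} y)"
        using that integrable_mult_indicator[OF _ integrable_abs[OF c_int], of "{a<..b}"]
          integrable_mult_indicator[OF _ integrable_abs[OF c_int], of "{xs-\<delta><..<xs+\<delta>}"]
        by (intro integral_mono) (auto simp: m mult.commute indicator_def)
      finally show ?thesis using \<delta>(2) by simp
    qed
    then show ?thesis using \<delta>(1) ab0 by (intro exI[of _ "min \<delta> (min (xs - a0) (b0 - xs))"]) auto
  qed
  then have "\<exists>d. (Q \<longlongrightarrow> d) (at xs)" by (rule tendsto_at_if_two_sided_Cauchy)
  then show ?thesis by (simp add: Q_def[abs_def] V_def)
qed

end
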